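(* A compact space $X$ is Corson if and only if it has a full $c$-skeleton.
   Context: All spaces are Tychonoff (completely regular and Hausdorff). For a set $T$, $\Sigma\mathbb{R}^T=\{f\in\mathbb{R}^T : |f^{-1}(\mathbb{R}\setminus\{0\})|\leq\omega\}$. A compact space $X$ is Corson if there is an embedding $\phi:X\to\mathbb{R}^T$, for some set $T$, with $\phi(X)\subseteq\Sigma\mathbb{R}^T$. $\Gamma$ denotes an up-directed $\sigma$-complete partially ordered set: any two elements have an upper bound, and every increasing sequence $s_0\leq s_1\leq\cdots$ in $\Gamma$ has a supremum in $\Gamma$. For a set $S$, $[S]^{\leq\omega}$ is the family of countable subsets of $S$. A map $\phi:\Gamma\to[S]^{\leq\omega}$ is $\omega$-monotone if $s\leq t$ implies $\phi(s)\subseteq\phi(t)$, and $\phi(\sup_n s_n)=\bigcup_n\phi(s_n)$ for every increasing sequence $(s_n)$ in $\Gamma$. A $c$-skeleton on a space $X$ is a family $\{(F_s,\mathcal{B}_s):s\in\Gamma\}$ (for some up-directed $\sigma$-complete partially ordered set $\Gamma$), where each $F_s$ is a closed subset of $X$ and each $\mathcal{B}_s$ is a countable family of open subsets of $X$, such that: (i) for each $s\in\Gamma$, $\mathcal{B}_s$ is a base for a topology $\tau_s$ on $X$, and there exist a Tychonoff space $Z_s$ and a continuous map $g_s:(X,\tau_s)\to Z_s$ which separates the points of $F_s$ (i.e. is injective on $F_s$); (ii) $F_s\subseteq F_t$ whenever $s\leq t$; (iii) the assignment $s\mapsto\mathcal{B}_s$ is $\omega$-monotone. The $c$-skeleton is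 full if $X=\bigcup_{s\in\Gamma}F_s$. *)

theory Defs
  imports "HOL-Analysis.Analysis"
begin

section \<open>Tychonoff and Corson spaces\<close>

definition tychonoff_space :: "'a topology \<Rightarrow> bool" where
  "tychonoff_space X \<longleftrightarrow> completely_regular_space X \<and> Hausdorff_space X"

text \<open>The points of \<open>powertop_real T\<close> are the functions that are \<open>undefined\<close> outside \<open>T\<close>,
  so the support has to be taken inside \<open>T\<close>.\<close>

definition sigma_product :: "'t set \<Rightarrow> ('t \<Rightarrow> real) set" where
  "sigma_product T = {f \<in> topspace (powertop_real T). countable {t \<in> T. f t \<noteq> 0}}"

definition corson_embedding :: "'a topology \<Rightarrow> 't set \<Rightarrow> ('a \<Rightarrow> 't \<Rightarrow> real) \<Rightarrow> bool" where
  "corson_embedding X T \<phi> \<longleftrightarrow>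
     embedding_map X (powertop_real T) \<phi> \<and> \<phi> ` topspace X \<subseteq> sigma_product T"

text \<open>A quantifier over sets needs a type for their elements. Taking the index set inside
  \<open>'a \<Rightarrow> real\<close> loses nothing: see \<open>corson_spaceI\<close> below, where the index type is arbitrary.\<close>

definition corson_space :: "'a topology \<Rightarrow> bool" where
  "corson_space X \<longleftrightarrow>
     compact_space X \<and> (\<exists>(T :: ('a \<Rightarrow> real) set) \<phi>. corson_embedding X T \<phi>)"


section \<open>Up-directed \<open>\<sigma>\<close>-complete partial orders\<close>

definition is_supremum :: "'s set \<Rightarrow> 's rel \<Rightarrow> 's set \<Rightarrow> 's \<Rightarrow> bool" where
  "is_supremum \<Gamma> r A u \<longleftrightarrow> u \<in> \<Gamma> \<and> (\<forall>a\<in>A. (a, u) \<in> r) \<and>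
     (\<forall>v\<in>\<Gamma>. (\<forall>a\<in>A. (a, v) \<in> r) \<longrightarrow> (u, v) \<in> r)"

definition increasing_sequence :: "'s set \<Rightarrow> 's rel \<Rightarrow> (nat \<Rightarrow> 's) \<Rightarrow> bool" where
  "increasing_sequence \<Gamma> r \<sigma> \<longleftrightarrow> (\<forall>n. \<sigma> n \<in> \<Gamma> \<and> (\<sigma> n, \<sigma> (Suc n)) \<in> r)"

definition directed_sigma_complete :: "'s set \<Rightarrow> 's rel \<Rightarrow> bool" where
  "directed_sigma_complete \<Gamma> r \<longleftrightarrow> partial_order_on \<Gamma> r \<and>
     (\<forall>s\<in>\<Gamma>. \<forall>t\<in>\<Gamma>. \<exists>u\<in>\<Gamma>. (s, u) \<in> r \<and> (t, u) \<in> r) \<and>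
     (\<forall>\<sigma>. increasing_sequence \<Gamma> r \<sigma> \<longrightarrow> (\<exists>u. is_supremum \<Gamma> r (range \<sigma>) u))"

definition omega_monotone :: "'s set \<Rightarrow> 's rel \<Rightarrow> 'b set \<Rightarrow> ('s \<Rightarrow> 'b set) \<Rightarrow> bool" where
  "omega_monotone \<Gamma> r S \<phi> \<longleftrightarrow>
     \<phi> \<in> \<Gamma> \<rightarrow> {A. A \<subseteq> S \<and> countable A} \<and>
     (\<forall>s\<in>\<Gamma>. \<forall>t\<in>\<Gamma>. (s, t) \<in> r \<longrightarrow> \<phi> s \<subseteq> \<phi> t) \<and>
     (\<forall>\<sigma> u. increasing_sequence \<Gamma> r \<sigma> \<and> is_supremum \<Gamma> r (range \<sigma>) u
        \<longrightarrow> \<phi> u = (\<Union>n. \<phi> (\<sigma> n)))"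


section \<open>\<open>c\<close>-skeletons\<close>

text \<open>The target \<open>Z\<close> may be taken on the type \<open>'a\<close>, since one can replace it by the image of
  \<open>g\<close>: see \<open>tychonoff_separatedI\<close> below, where the type of \<open>Z\<close> is arbitrary.\<close>

definition tychonoff_separated :: "'a topology \<Rightarrow> 'a set \<Rightarrow> bool" where
  "tychonoff_separated \<tau> A \<longleftrightarrow>
     (\<exists>(Z :: 'a topology) g. tychonoff_space Z \<and> continuous_map \<tau> Z g \<and> inj_on g A)"

definition c_skeleton ::
  "'a topology \<Rightarrow> 's set \<Rightarrow> 's rel \<Rightarrow> ('s \<Rightarrow> 'a set) \<Rightarrow> ('s \<Rightarrow> 'a set set) \<Rightarrow> bool" where
  "c_skeleton X \<Gamma> r F \<B> \<longleftrightarrow>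
     directed_sigma_complete \<Gamma> r \<and>
     (\<forall>s\<in>\<Gamma>. closedin X (F s)) \<and>
     (\<forall>s\<in>\<Gamma>. countable (\<B> s) \<and> (\<forall>U\<in>\<B> s. openin X U)) \<and>
     (\<forall>s\<in>\<Gamma>. \<exists>\<tau>. topspace \<tau> = topspace X \<and> openin \<tau> = arbitrary union_of (\<lambda>U. U \<in> \<B> s) \<and>
        tychonoff_separated \<tau> (F s)) \<and>
     (\<forall>s\<in>\<Gamma>. \<forall>t\<in>\<Gamma>. (s, t) \<in> r \<longrightarrow> F s \<subseteq> F t) \<and>
     omega_monotone \<Gamma> r {U. openin X U} \<B>"

definition full_c_skeleton ::
  "'a topology \<Rightarrow> 's set \<Rightarrow> 's rel \<Rightarrow> ('s \<Rightarrow> 'a set) \<Rightarrow> ('s \<Rightarrow> 'a set set) \<Rightarrow> bool" where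
  "full_c_skeleton X \<Gamma> r F \<B> \<longleftrightarrow> c_skeleton X \<Gamma> r F \<B> \<and> topspace X = (\<Union>s\<in>\<Gamma>. F s)"

text \<open>Again \<open>'a \<Rightarrow> real\<close> is large enough to contain the index set: see \<open>has_full_c_skeletonI\<close>
  below, where the index type is arbitrary.\<close>

definition has_full_c_skeleton :: "'a topology \<Rightarrow> bool" where
  "has_full_c_skeleton X \<longleftrightarrow>
     (\<exists>(\<Gamma> :: ('a \<Rightarrow> real) set) r F \<B>. full_c_skeleton X \<Gamma> r F \<B>)"


section \<open>Independence of the chosen types\<close>

lemma corson_spaceI:
  fixes X :: "'a topology" and T :: "'t set"
  assumes "compact_space X" and emb: "corson_embedding X T \<phi>"
  shows "corson_space X"
proof -
  define k where "k t = (\<lambda>x. if x \<in> topspace X then \<phi> x t else 0)" for t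
  define T' where "T' = k ` T"
  define \<phi>' where "\<phi>' x = (\<lambda>f\<in>T'. f x)" for x
  define \<sigma> where "\<sigma> y = (\<lambda>t\<in>T. y (k t))" for y :: "('a \<Rightarrow> real) \<Rightarrow> real"
  have em: "embedding_map X (powertop_real T) \<phi>"
    and sp: "\<phi> ` topspace X \<subseteq> sigma_product T"
    using emb by (auto simp: corson_embedding_def)
  obtain h where h: "homeomorphic_maps X (subtopology (powertop_real T) (\<phi> ` topspace X)) \<phi> h"
    using em by (auto simp: embedding_map_def homeomorphic_map_maps)
  have cphi: "continuous_map X (powertop_real T) \<phi>"
    using h by (auto simp: homeomorphic_maps_def continuous_map_in_subtopology)
  have ck: "continuous_map X euclideanreal (k t)" if "t \<in> T" for t
  proof -
    have "continuous_map X euclideanreal (\<lambda>x. \<phi> x t)"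
      using cphi that by (simp add: continuous_map_componentwise)
    then show ?thesis
      by (rule continuous_map_eq) (simp add: k_def)
  qed
  have cphi': "continuous_map X (powertop_real T') \<phi>'"
  proof (subst continuous_map_componentwise, intro conjI ballI)
    show "\<phi>' ` topspace X \<subseteq> extensional T'"
      by (auto simp: \<phi>'_def)
    fix f assume "f \<in> T'"
    then show "continuous_map X euclideanreal (\<lambda>x. \<phi>' x f)"
      using ck by (auto simp: \<phi>'_def T'_def)
  qed
  have csig: "continuous_map (powertop_real T') (powertop_real T) \<sigma>"
  proof (subst continuous_map_componentwise, intro conjI ballI)
    show "\<sigma> ` topspace (powertop_real T') \<subseteq> extensional T"
      by (auto simp: \<sigma>_def)
    fix t assume "t \<in> T"
    then have "k t \<in> T'" by (simp add: T'_def)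
    from continuous_map_product_projection[OF this, of "\<lambda>_. euclideanreal"]
    show "continuous_map (powertop_real T') euclideanreal (\<lambda>y. \<sigma> y t)"
      using \<open>t \<in> T\<close> by (simp add: \<sigma>_def)
  qed
  have comp: "\<sigma> (\<phi>' x) = \<phi> x" if "x \<in> topspace X" for x
  proof
    fix t
    have "\<phi> x \<in> extensional T"
      using sp that by (auto simp: sigma_product_def PiE_def)
    then show "\<sigma> (\<phi>' x) t = \<phi> x t"
      using that by (auto simp: \<sigma>_def \<phi>'_def T'_def k_def extensional_def)
  qed
  have "homeomorphic_maps X (subtopology (powertop_real T') (\<phi>' ` topspace X)) \<phi>' (h \<circ> \<sigma>)"
    unfolding homeomorphic_maps_def
  proof (intro conjI)
    show "continuous_map X (subtopology (powertop_real T') (\<phi>' ` topspace X)) \<phi>'"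
      using cphi' by (auto simp: continuous_map_in_subtopology)
    have "continuous_map (subtopology (powertop_real T') (\<phi>' ` topspace X))
        (subtopology (powertop_real T) (\<phi> ` topspace X)) \<sigma>"
      using csig comp by (auto simp: continuous_map_in_subtopology continuous_map_from_subtopology)
    then show "continuous_map (subtopology (powertop_real T') (\<phi>' ` topspace X)) X (h \<circ> \<sigma>)"
      using h by (auto simp: homeomorphic_maps_def intro: continuous_map_compose)
    show "\<forall>x\<in>topspace X. (h \<circ> \<sigma>) (\<phi>' x) = x"
      using h comp by (simp add: homeomorphic_maps_def)
    then show "\<forall>y\<in>topspace (subtopology (powertop_real T') (\<phi>' ` topspace X)).
        \<phi>' ((h \<circ> \<sigma>) y) = y"
      by auto
  qed
  then have "embedding_map X (powertop_real T') \<phi>'"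
    by (auto simp: embedding_map_def homeomorphic_map_maps)
  moreover have "\<phi>' x \<in> sigma_product T'" if x: "x \<in> topspace X" for x
  proof -
    have "{f \<in> T'. \<phi>' x f \<noteq> 0} \<subseteq> k ` {t \<in> T. \<phi> x t \<noteq> 0}"
      using x by (auto simp: T'_def \<phi>'_def k_def)
    moreover have "countable {t \<in> T. \<phi> x t \<noteq> 0}"
      using sp x by (auto simp: sigma_product_def)
    ultimately have "countable {f \<in> T'. \<phi>' x f \<noteq> 0}"
      by (meson countable_image countable_subset)
    then show ?thesis
      by (auto simp: sigma_product_def \<phi>'_def)
  qed
  ultimately show ?thesis
    using assms(1) unfolding corson_space_def corson_embedding_def by blast
qed

lemma tychonoff_separatedI:
  fixes \<tau> :: "'a topology" and Z :: "'z topology"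
  assumes Z: "tychonoff_space Z" and g: "continuous_map \<tau> Z g"
    and A: "A \<subseteq> topspace \<tau>" and inj: "inj_on g A"
  shows "tychonoff_separated \<tau> A"
proof -
  define j where "j = inv_into (topspace \<tau>) g"
  define S where "S = j ` g ` topspace \<tau>"
  define Z' where "Z' = pullback_topology S g Z"
  have gj: "g (j z) = z" "j z \<in> topspace \<tau>" if "z \<in> g ` topspace \<tau>" for z
    using that by (auto simp: j_def f_inv_into_f inv_into_into)
  have gZ: "g ` topspace \<tau> \<subseteq> topspace Z"
    using g by (rule continuous_map_image_subset_topspace)
  have tZ': "topspace Z' = S"
    using gj gZ by (auto simp: Z'_def topspace_pullback_topology S_def)
  have cj: "continuous_map (subtopology Z (g ` topspace \<tau>)) Z' j"
    unfolding continuous_map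
  proof (intro conjI allI impI)
    show "j ` topspace (subtopology Z (g ` topspace \<tau>)) \<subseteq> topspace Z'"
      by (auto simp: tZ' S_def)
    fix U assume "openin Z' U"
    then obtain V where V: "openin Z V" "U = g -` V \<inter> S"
      by (auto simp: Z'_def openin_pullback_topology)
    have "{x \<in> topspace (subtopology Z (g ` topspace \<tau>)). j x \<in> U} = V \<inter> g ` topspace \<tau>"
    proof -
      have "j z \<in> U \<longleftrightarrow> z \<in> V" if "z \<in> g ` topspace \<tau>" for z
        using gj(1)[OF that] that by (simp add: V S_def)
      then show ?thesis using gZ by auto
    qed
    then show "openin (subtopology Z (g ` topspace \<tau>))
        {x \<in> topspace (subtopology Z (g ` topspace \<tau>)). j x \<in> U}"
      using V by (auto simp: openin_subtopology)
  qed
  have cg: "continuous_map Z' (subtopology Z (g ` topspace \<tau>)) g"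
  proof -
    have "continuous_map Z' Z (id \<circ> g)"
      unfolding Z'_def by (rule continuous_map_pullback) simp
    then show ?thesis
      using gj by (auto simp: continuous_map_in_subtopology tZ' S_def)
  qed
  have "homeomorphic_maps (subtopology Z (g ` topspace \<tau>)) Z' j g"
    unfolding homeomorphic_maps_def using cj cg gj by (auto simp: tZ' S_def)
  then have hom: "subtopology Z (g ` topspace \<tau>) homeomorphic_space Z'"
    by (auto simp: homeomorphic_space_def)
  have "tychonoff_space Z'"
    using Z homeomorphic_completely_regular_space[OF hom] homeomorphic_Hausdorff_space[OF hom]
    by (simp add: tychonoff_space_def completely_regular_space_subtopology
        Hausdorff_space_subtopology)
  moreover have "continuous_map \<tau> Z' (j \<circ> g)"
    using g cj by (intro continuous_map_compose) (auto simp: continuous_map_in_subtopology)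
  moreover have "inj_on (j \<circ> g) A"
  proof (rule inj_onI)
    fix x y assume "x \<in> A" "y \<in> A" and eq: "(j \<circ> g) x = (j \<circ> g) y"
    then have "j (g x) = j (g y)" "g x \<in> g ` topspace \<tau>" "g y \<in> g ` topspace \<tau>"
      using A by auto
    then have "g x = g y"
      using gj(1) by metis
    then show "x = y"
      using inj \<open>x \<in> A\<close> \<open>y \<in> A\<close> by (auto dest: inj_onD)
  qed
  ultimately show ?thesis
    unfolding tychonoff_separated_def by blast
qed

text \<open>For the index set \<open>\<Gamma>\<close> of a full \<open>c\<close>-skeleton, choose for each point \<open>x\<close> an index \<open>s\<close> with
  \<open>x \<in> F s\<close> and close off under upper bounds of pairs and suprema of increasing sequences. The
  elements of the closure are the values of countably branching well-founded trees with leaves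
  in \<open>'a\<close>, and these trees can be coded in \<open>'a \<Rightarrow> real\<close>.\<close>

datatype 'a sup_tree = Leaf 'a | Node "nat \<Rightarrow> 'a sup_tree"

primrec tree_code :: "'a sup_tree \<Rightarrow> (nat list \<times> 'a) set" where
  "tree_code (Leaf x) = {([], x)}"
| "tree_code (Node f) = (\<Union>n. (\<lambda>(l, x). (n # l, x)) ` tree_code (f n))"

primrec tree_value :: "('a \<Rightarrow> 's) \<Rightarrow> ((nat \<Rightarrow> 's) \<Rightarrow> 's) \<Rightarrow> 'a sup_tree \<Rightarrow> 's" where
  "tree_value p c (Leaf x) = p x"
| "tree_value p c (Node f) = c (\<lambda>n. tree_value p c (f n))"

lemma inj_tree_code: "inj tree_code"
proof (rule injI)
  fix s t :: "'a sup_tree"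
  assume "tree_code s = tree_code t"
  then show "s = t"
  proof (induction s arbitrary: t)
    case (Leaf x)
    then show ?case by (cases t) auto
  next
    case (Node f)
    show ?case
    proof (cases t)
      case (Leaf x)
      then show ?thesis using Node.prems by auto
    next
      fix g assume t: "t = Node g"
      have sub: "tree_code (h n) = {(l, x). (n # l, x) \<in> tree_code (Node h)}"
        for h :: "nat \<Rightarrow> 'a sup_tree" and n
        by auto
      have "tree_code (f n) = tree_code (g n)" for n
        using Node.prems sub[of f n] sub[of g n] by (simp only: t)
      then show ?thesis
        using Node.IH by (auto simp: t)
    qed
  qed
qed

lemma ex_inj_sup_tree: "\<exists>e :: 'a sup_tree \<Rightarrow> 'a \<Rightarrow> real. inj e"
proof -
  obtain b :: "nat set \<Rightarrow> real" where b: "inj b"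
    using nat_sets_eqpoll_reals by (auto simp: eqpoll_def bij_betw_def)
  define e where "e t x = b (to_nat ` {l. (l, x) \<in> tree_code t})" for t :: "'a sup_tree" and x
  have "inj e"
  proof (rule injI)
    fix s t assume eq: "e s = e t"
    have "to_nat ` {l. (l, x) \<in> tree_code s} = to_nat ` {l. (l, x) \<in> tree_code t}" for x
      using fun_cong[OF eq, of x] by (simp only: e_def inj_eq[OF b])
    then have "{l. (l, x) \<in> tree_code s} = {l. (l, x) \<in> tree_code t}" for x
      by (simp add: inj_image_eq_iff)
    then have "tree_code s = tree_code t"
      by auto
    then show "s = t"
      using inj_tree_code by (auto dest: injD)
  qed
  then show ?thesis by blast
qed

lemma c_skeletonD:
  assumes "c_skeleton X \<Gamma> r F \<B>"
  shows "partial_order_on \<Gamma> r"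
    and "\<And>s t. s \<in> \<Gamma> \<Longrightarrow> t \<in> \<Gamma> \<Longrightarrow> \<exists>u\<in>\<Gamma>. (s, u) \<in> r \<and> (t, u) \<in> r"
    and "\<And>\<sigma>. increasing_sequence \<Gamma> r \<sigma> \<Longrightarrow> \<exists>u. is_supremum \<Gamma> r (range \<sigma>) u"
    and "\<And>s. s \<in> \<Gamma> \<Longrightarrow> closedin X (F s)"
    and "\<And>s. s \<in> \<Gamma> \<Longrightarrow> countable (\<B> s) \<and> (\<forall>U\<in>\<B> s. openin X U)"
    and "\<And>s. s \<in> \<Gamma> \<Longrightarrow> \<exists>\<tau>. topspace \<tau> = topspace X \<and>
      openin \<tau> = arbitrary union_of (\<lambda>U. U \<in> \<B> s) \<and> tychonoff_separated \<tau> (F s)"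
    and "\<And>s t. s \<in> \<Gamma> \<Longrightarrow> t \<in> \<Gamma> \<Longrightarrow> (s, t) \<in> r \<Longrightarrow> F s \<subseteq> F t"
    and "\<And>s t. s \<in> \<Gamma> \<Longrightarrow> t \<in> \<Gamma> \<Longrightarrow> (s, t) \<in> r \<Longrightarrow> \<B> s \<subseteq> \<B> t"
    and "\<And>\<sigma> u. increasing_sequence \<Gamma> r \<sigma> \<Longrightarrow> is_supremum \<Gamma> r (range \<sigma>) u \<Longrightarrow>
      \<B> u = (\<Union>n. \<B> (\<sigma> n))"
  using assms unfolding c_skeleton_def directed_sigma_complete_def omega_monotone_def
  by simp_all

lemma full_c_skeleton_subset:
  fixes \<Gamma> :: "'s set"
  assumes full: "full_c_skeleton X \<Gamma> r F \<B>" and "\<Delta> \<subseteq> \<Gamma>"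
    and up: "\<And>s t. s \<in> \<Delta> \<Longrightarrow> t \<in> \<Delta> \<Longrightarrow> \<exists>u\<in>\<Delta>. (s, u) \<in> r \<and> (t, u) \<in> r"
    and sup: "\<And>\<sigma>. increasing_sequence \<Delta> r \<sigma> \<Longrightarrow> \<exists>u\<in>\<Delta>. is_supremum \<Gamma> r (range \<sigma>) u"
    and cover: "topspace X \<subseteq> (\<Union>s\<in>\<Delta>. F s)"
  shows "full_c_skeleton X \<Delta> (r \<inter> \<Delta> \<times> \<Delta>) F \<B>"
proof -
  let ?q = "r \<inter> \<Delta> \<times> \<Delta>"
  have "c_skeleton X \<Gamma> r F \<B>" and "topspace X = (\<Union>s\<in>\<Gamma>. F s)"
    using full by (simp_all only: full_c_skeleton_def)
  note sk = c_skeletonD[OF this(1)] this(2)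
  note po = sk(1)
  have anti: "x = y" if "(x, y) \<in> r" "(y, x) \<in> r" for x y
    using po that by (auto simp: partial_order_on_def antisym_def)
  have po': "partial_order_on \<Delta> ?q"
    using po \<open>\<Delta> \<subseteq> \<Gamma>\<close>
    by (auto simp: partial_order_on_def preorder_on_def refl_on_def trans_def antisym_def)
  have inc: "increasing_sequence \<Delta> r \<sigma>" "increasing_sequence \<Gamma> r \<sigma>"
    if "increasing_sequence \<Delta> ?q \<sigma>" for \<sigma>
    using that \<open>\<Delta> \<subseteq> \<Gamma>\<close> by (auto simp: increasing_sequence_def)
  have sup': "is_supremum \<Delta> ?q (range \<sigma>) u"
    if "increasing_sequence \<Delta> ?q \<sigma>" "u \<in> \<Delta>" "is_supremum \<Gamma> r (range \<sigma>) u" for \<sigma> u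
    using that \<open>\<Delta> \<subseteq> \<Gamma>\<close> by (auto simp: is_supremum_def increasing_sequence_def)
  have dsc: "directed_sigma_complete \<Delta> ?q"
    unfolding directed_sigma_complete_def
  proof (intro conjI ballI allI impI po')
    fix s t assume "s \<in> \<Delta>" "t \<in> \<Delta>"
    then show "\<exists>u\<in>\<Delta>. (s, u) \<in> ?q \<and> (t, u) \<in> ?q"
      using up[of s t] by blast
  next
    fix \<sigma> assume "increasing_sequence \<Delta> ?q \<sigma>"
    then show "\<exists>u. is_supremum \<Delta> ?q (range \<sigma>) u"
      using sup[of \<sigma>] inc(1)[of \<sigma>] sup'[of \<sigma>] by blast
  qed
  have om: "omega_monotone \<Delta> ?q {U. openin X U} \<B>"
    unfolding omega_monotone_def
  proof (intro conjI ballI allI impI)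
    show "\<B> \<in> \<Delta> \<rightarrow> {A. A \<subseteq> {U. openin X U} \<and> countable A}"
      using sk(5) \<open>\<Delta> \<subseteq> \<Gamma>\<close> by auto
    fix s t assume "s \<in> \<Delta>" "t \<in> \<Delta>" "(s, t) \<in> ?q"
    then show "\<B> s \<subseteq> \<B> t" using sk(8)[of s t] \<open>\<Delta> \<subseteq> \<Gamma>\<close> by blast
  next
    fix \<sigma> u assume *: "increasing_sequence \<Delta> ?q \<sigma> \<and> is_supremum \<Delta> ?q (range \<sigma>) u"
    then obtain v where v: "v \<in> \<Delta>" "is_supremum \<Gamma> r (range \<sigma>) v"
      using sup[of \<sigma>] inc(1)[of \<sigma>] by blast
    have "is_supremum \<Delta> ?q (range \<sigma>) v"
      using sup' v * by blast
    then have "(u, v) \<in> r" "(v, u) \<in> r"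
      using * by (auto simp: is_supremum_def)
    then have "u = v" by (rule anti)
    moreover have "\<B> v = (\<Union>n. \<B> (\<sigma> n))"
      using sk(9)[OF inc(2) v(2)] * by blast
    ultimately show "\<B> u = (\<Union>n. \<B> (\<sigma> n))" by simp
  qed
  have "(\<Union>s\<in>\<Delta>. F s) \<subseteq> topspace X"
    using sk(10) \<open>\<Delta> \<subseteq> \<Gamma>\<close> by blast
  moreover have "\<forall>s\<in>\<Delta>. closedin X (F s)"
    "\<forall>s\<in>\<Delta>. countable (\<B> s) \<and> (\<forall>U\<in>\<B> s. openin X U)"
    "\<forall>s\<in>\<Delta>. \<exists>\<tau>. topspace \<tau> = topspace X \<and> openin \<tau> = arbitrary union_of (\<lambda>U. U \<in> \<B> s) \<and>
        tychonoff_separated \<tau> (F s)"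
    "\<forall>s\<in>\<Delta>. \<forall>t\<in>\<Delta>. (s, t) \<in> ?q \<longrightarrow> F s \<subseteq> F t"
    using sk(4-7) \<open>\<Delta> \<subseteq> \<Gamma>\<close> by (meson subsetD IntD1)+
  ultimately show ?thesis
    unfolding full_c_skeleton_def c_skeleton_def using dsc om cover by blast
qed

lemma full_c_skeleton_image:
  fixes \<Gamma> :: "'s set" and e :: "'s \<Rightarrow> 'u"
  assumes full: "full_c_skeleton X \<Gamma> r F \<B>" and inj: "inj_on e \<Gamma>"
  defines "d \<equiv> inv_into \<Gamma> e"
  defines "q \<equiv> {(a, b). a \<in> e ` \<Gamma> \<and> b \<in> e ` \<Gamma> \<and> (d a, d b) \<in> r}"
  shows "full_c_skeleton X (e ` \<Gamma>) q (F \<circ> d) (\<B> \<circ> d)"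
proof -
  define \<Delta> where "\<Delta> = e ` \<Gamma>"
  have "c_skeleton X \<Gamma> r F \<B>" and "topspace X = (\<Union>s\<in>\<Gamma>. F s)"
    using full by (simp_all only: full_c_skeleton_def)
  note sk = c_skeletonD[OF this(1)] this(2)
  have de: "d (e s) = s" if "s \<in> \<Gamma>" for s
    using inj that by (simp add: d_def)
  have d\<Gamma>: "d a \<in> \<Gamma>" "e (d a) = a" if "a \<in> \<Delta>" for a
    using de that by (auto simp: \<Delta>_def)
  have e\<Delta>: "e s \<in> \<Delta>" if "s \<in> \<Gamma>" for s
    using that by (simp add: \<Delta>_def)
  have q: "(a, b) \<in> q \<longleftrightarrow> a \<in> \<Delta> \<and> b \<in> \<Delta> \<and> (d a, d b) \<in> r" for a b
    by (simp add: q_def \<Delta>_def)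
  note po = sk(1)
  have po': "partial_order_on \<Delta> q"
    unfolding partial_order_on_def preorder_on_def
  proof (intro conjI)
    show "q \<subseteq> \<Delta> \<times> \<Delta>" by (auto simp: q)
    show "refl_on \<Delta> q"
      using po d\<Gamma>(1) by (simp add: refl_on_def q partial_order_on_def preorder_on_def)
    show "trans q"
    proof (rule transI)
      fix a b c assume "(a, b) \<in> q" "(b, c) \<in> q"
      moreover have "trans r" using po by (simp add: partial_order_on_def preorder_on_def)
      ultimately show "(a, c) \<in> q" by (unfold q) (blast dest: transD)
    qed
    show "antisym q"
    proof (rule antisymI)
      fix a b assume *: "(a, b) \<in> q" "(b, a) \<in> q"
      have "antisym r" using po by (simp add: partial_order_on_def)
      moreover have "(d a, d b) \<in> r" "(d b, d a) \<in> r" using * by (simp_all add: q)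
      ultimately have "d a = d b" by (rule antisymD)
      moreover have "a \<in> \<Delta>" "b \<in> \<Delta>" using * by (auto simp: q)
      ultimately show "a = b" using d\<Gamma>(2) by metis
    qed
  qed
  have inc: "increasing_sequence \<Gamma> r (d \<circ> \<sigma>)" if "increasing_sequence \<Delta> q \<sigma>" for \<sigma>
    using that d\<Gamma> by (auto simp: increasing_sequence_def q)
  have sup: "is_supremum \<Delta> q (range \<sigma>) a \<longleftrightarrow> a \<in> \<Delta> \<and> is_supremum \<Gamma> r (range (d \<circ> \<sigma>)) (d a)"
    if "increasing_sequence \<Delta> q \<sigma>" for \<sigma> a
  proof -
    have \<sigma>: "\<sigma> n \<in> \<Delta>" for n
      using that by (simp add: increasing_sequence_def)
    show ?thesis
    proof (cases "a \<in> \<Delta>")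
      case True
      have "(\<forall>v\<in>\<Delta>. (\<forall>n. (\<sigma> n, v) \<in> q) \<longrightarrow> (a, v) \<in> q) \<longleftrightarrow>
          (\<forall>v\<in>\<Gamma>. (\<forall>n. (d (\<sigma> n), v) \<in> r) \<longrightarrow> (d a, v) \<in> r)"
        using True \<sigma> de by (simp add: q e\<Delta>) (auto simp: \<Delta>_def)
      then show ?thesis
        using True \<sigma> d\<Gamma>(1)[OF True] by (simp add: is_supremum_def q)
    qed (simp add: is_supremum_def)
  qed
  have dsc: "directed_sigma_complete \<Delta> q"
    unfolding directed_sigma_complete_def
  proof (intro conjI ballI allI impI po')
    fix a b assume ab: "a \<in> \<Delta>" "b \<in> \<Delta>"
    then obtain u where "u \<in> \<Gamma>" "(d a, u) \<in> r" "(d b, u) \<in> r"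
      using sk(2) d\<Gamma>(1) by meson
    then show "\<exists>u\<in>\<Delta>. (a, u) \<in> q \<and> (b, u) \<in> q"
      using ab de e\<Delta> by (intro bexI[of _ "e u"]) (auto simp: q)
  next
    fix \<sigma> assume \<sigma>: "increasing_sequence \<Delta> q \<sigma>"
    obtain u where u: "is_supremum \<Gamma> r (range (d \<circ> \<sigma>)) u"
      using sk(3)[OF inc[OF \<sigma>]] by blast
    then have "u \<in> \<Gamma>" by (simp add: is_supremum_def)
    then show "\<exists>u. is_supremum \<Delta> q (range \<sigma>) u"
      using u de e\<Delta> sup[OF \<sigma>, of "e u"] by auto
  qed
  have om: "omega_monotone \<Delta> q {U. openin X U} (\<B> \<circ> d)"
    unfolding omega_monotone_def
  proof (intro conjI ballI allI impI)
    show "\<B> \<circ> d \<in> \<Delta> \<rightarrow> {A. A \<subseteq> {U. openin X U} \<and> countable A}"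
      using sk(5) d\<Gamma>(1) by (fastforce simp: Pi_iff)
    fix a b assume "a \<in> \<Delta>" "b \<in> \<Delta>" "(a, b) \<in> q"
    then have "d a \<in> \<Gamma>" "d b \<in> \<Gamma>" "(d a, d b) \<in> r"
      using d\<Gamma> by (auto simp: q)
    then show "(\<B> \<circ> d) a \<subseteq> (\<B> \<circ> d) b" using sk(8) by auto
  next
    fix \<sigma> a assume *: "increasing_sequence \<Delta> q \<sigma> \<and> is_supremum \<Delta> q (range \<sigma>) a"
    then have "is_supremum \<Gamma> r (range (d \<circ> \<sigma>)) (d a)"
      using sup by blast
    then have "\<B> (d a) = (\<Union>n. \<B> ((d \<circ> \<sigma>) n))"
      using sk(9) inc * by blast
    then show "(\<B> \<circ> d) a = (\<Union>n. (\<B> \<circ> d) (\<sigma> n))" by simp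
  qed
  have "topspace X = (\<Union>a\<in>\<Delta>. (F \<circ> d) a)"
    using sk(10) de by (auto simp: \<Delta>_def)
  moreover have "\<forall>a\<in>\<Delta>. closedin X ((F \<circ> d) a)"
    using sk(4)[OF d\<Gamma>(1)] by simp
  moreover have "\<forall>a\<in>\<Delta>. countable ((\<B> \<circ> d) a) \<and> (\<forall>U\<in>(\<B> \<circ> d) a. openin X U)"
    using sk(5)[OF d\<Gamma>(1)] by (simp only: comp_apply) blast
  moreover have "\<forall>a\<in>\<Delta>. \<exists>\<tau>. topspace \<tau> = topspace X \<and>
      openin \<tau> = arbitrary union_of (\<lambda>U. U \<in> (\<B> \<circ> d) a) \<and> tychonoff_separated \<tau> ((F \<circ> d) a)"
    using sk(6)[OF d\<Gamma>(1)] by (simp only: comp_apply) blast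
  moreover have "\<forall>a\<in>\<Delta>. \<forall>b\<in>\<Delta>. (a, b) \<in> q \<longrightarrow> (F \<circ> d) a \<subseteq> (F \<circ> d) b"
  proof (intro ballI impI)
    fix a b assume "a \<in> \<Delta>" "b \<in> \<Delta>" "(a, b) \<in> q"
    then have "d a \<in> \<Gamma>" "d b \<in> \<Gamma>" "(d a, d b) \<in> r"
      using d\<Gamma> by (auto simp: q)
    then show "(F \<circ> d) a \<subseteq> (F \<circ> d) b" using sk(7) by auto
  qed
  ultimately have "full_c_skeleton X \<Delta> q (F \<circ> d) (\<B> \<circ> d)"
    unfolding full_c_skeleton_def c_skeleton_def using dsc om by blast
  then show ?thesis by (simp only: \<Delta>_def)
qed

lemma has_full_c_skeletonI:
  fixes X :: "'a topology" and \<Gamma> :: "'s set"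
  assumes full: "full_c_skeleton X \<Gamma> r F \<B>"
  shows "has_full_c_skeleton X"
proof (cases "\<Gamma> = {}")
  case True
  then have "inj_on (\<lambda>_. undefined :: 'a \<Rightarrow> real) \<Gamma>" by simp
  from full_c_skeleton_image[OF full this] show ?thesis
    unfolding has_full_c_skeleton_def by blast
next
  case False
  have "c_skeleton X \<Gamma> r F \<B>" and "topspace X = (\<Union>s\<in>\<Gamma>. F s)"
    using full by (simp_all only: full_c_skeleton_def)
  note sk = c_skeletonD[OF this(1)] this(2)
  have "\<exists>s\<in>\<Gamma>. x \<in> topspace X \<longrightarrow> x \<in> F s" for x
    using sk(10) False by blast
  then obtain p where p: "\<And>x. p x \<in> \<Gamma>" "\<And>x. x \<in> topspace X \<Longrightarrow> x \<in> F (p x)"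
    by metis
  have "\<exists>u. (range \<sigma> \<subseteq> \<Gamma> \<longrightarrow> u \<in> \<Gamma>) \<and>
      (increasing_sequence \<Gamma> r \<sigma> \<longrightarrow> is_supremum \<Gamma> r (range \<sigma>) u) \<and>
      (range \<sigma> \<subseteq> \<Gamma> \<longrightarrow> (\<sigma> 0, u) \<in> r \<and> (\<sigma> 1, u) \<in> r)" for \<sigma>
  proof (cases "increasing_sequence \<Gamma> r \<sigma>")
    case True
    then obtain u where "is_supremum \<Gamma> r (range \<sigma>) u" using sk(3) by blast
    then show ?thesis by (auto simp: is_supremum_def)
  next
    case False
    show ?thesis
    proof (cases "range \<sigma> \<subseteq> \<Gamma>")
      case True
      then have "\<sigma> 0 \<in> \<Gamma>" "\<sigma> 1 \<in> \<Gamma>" by auto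
      then obtain u where "u \<in> \<Gamma>" "(\<sigma> 0, u) \<in> r" "(\<sigma> 1, u) \<in> r" using sk(2) by meson
      then show ?thesis using False by blast
    qed (use False in auto)
  qed
  then obtain c where c: "\<And>\<sigma>. range \<sigma> \<subseteq> \<Gamma> \<Longrightarrow> c \<sigma> \<in> \<Gamma>"
      "\<And>\<sigma>. increasing_sequence \<Gamma> r \<sigma> \<Longrightarrow> is_supremum \<Gamma> r (range \<sigma>) (c \<sigma>)"
      "\<And>\<sigma>. range \<sigma> \<subseteq> \<Gamma> \<Longrightarrow> (\<sigma> 0, c \<sigma>) \<in> r \<and> (\<sigma> 1, c \<sigma>) \<in> r"
    by metis
  define v where "v = tree_value p c"
  define \<Delta> where "\<Delta> = range v"
  have v\<Gamma>: "v t \<in> \<Gamma>" for t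
    by (induction t) (auto simp: v_def p intro!: c(1))
  have c\<Delta>: "c \<sigma> \<in> \<Delta>" if "\<And>n. \<sigma> n \<in> \<Delta>" for \<sigma>
  proof -
    have "\<exists>t. \<sigma> n = v t" for n using that[of n] by (auto simp: \<Delta>_def)
    then obtain f where "\<And>n. \<sigma> n = v (f n)" by metis
    then have "\<sigma> = (\<lambda>n. v (f n))" by auto
    then have "c \<sigma> = v (Node f)" by (simp add: v_def)
    then show ?thesis by (simp add: \<Delta>_def)
  qed
  have "\<Delta> \<subseteq> \<Gamma>" using v\<Gamma> by (auto simp: \<Delta>_def)
  have full': "full_c_skeleton X \<Delta> (r \<inter> \<Delta> \<times> \<Delta>) F \<B>"
  proof (rule full_c_skeleton_subset[OF full \<open>\<Delta> \<subseteq> \<Gamma>\<close>])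
    fix s t assume st: "s \<in> \<Delta>" "t \<in> \<Delta>"
    define \<sigma> where "\<sigma> n = (if n = 0 then s else t)" for n :: nat
    have "\<sigma> n \<in> \<Delta>" for n using st by (simp add: \<sigma>_def)
    moreover from this have "range \<sigma> \<subseteq> \<Gamma>" using \<open>\<Delta> \<subseteq> \<Gamma>\<close> by auto
    ultimately show "\<exists>u\<in>\<Delta>. (s, u) \<in> r \<and> (t, u) \<in> r"
      using c(3)[of \<sigma>] c\<Delta>[of \<sigma>] by (auto simp: \<sigma>_def)
  next
    fix \<sigma> assume "increasing_sequence \<Delta> r \<sigma>"
    moreover from this have "increasing_sequence \<Gamma> r \<sigma>"
      using \<open>\<Delta> \<subseteq> \<Gamma>\<close> by (auto simp: increasing_sequence_def)
    ultimately show "\<exists>u\<in>\<Delta>. is_supremum \<Gamma> r (range \<sigma>) u"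
      using c(2)[of \<sigma>] c\<Delta>[of \<sigma>] by (auto simp: increasing_sequence_def)
  next
    have "p x \<in> \<Delta>" for x
      by (auto simp: \<Delta>_def v_def intro!: range_eqI[of _ _ "Leaf x"])
    then show "topspace X \<subseteq> (\<Union>s\<in>\<Delta>. F s)" using p(2) by blast
  qed
  obtain e :: "'a sup_tree \<Rightarrow> 'a \<Rightarrow> real" where "inj e"
    using ex_inj_sup_tree by blast
  then have "inj_on (e \<circ> inv v) \<Delta>"
    by (auto simp: \<Delta>_def intro!: comp_inj_on inj_on_inv_into inj_on_subset[of e UNIV])
  from full_c_skeleton_image[OF full' this] show ?thesis
    unfolding has_full_c_skeleton_def by blast
qed

end

theory Submission
  imports Defs
begin

text \<open>If \<open>X\<close> lies in a \<open>\<Sigma>\<close>-product of lines, then the countable sets \<open>A\<close> of coordinates index a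
  full \<open>c\<close>-skeleton: \<open>F A\<close> consists of the points supported in \<open>A\<close>, the rational boxes in the
  coordinates from \<open>A\<close> are the base, and the projection to these coordinates is injective on \<open>F A\<close>.

  For the converse, a \<open>c\<close>-skeleton yields retractions. Say that a family \<open>\<U>\<close> of open sets does not
  separate \<open>x\<close> from \<open>y\<close> if these points have no disjoint neighbourhoods in \<open>\<U>\<close>. Points of \<open>F s\<close> are
  separated by \<open>\<B> s\<close>, and if \<open>F s\<close> is dense for the topology generated by \<open>\<B> s\<close>, then compactness
  gives for every \<open>x\<close> exactly one point of \<open>F s\<close> that is not separated from \<open>x\<close>. Passing to that point
  is a continuous retraction onto \<open>F s\<close>. The indices with this density are cofinal, so an index can be
  chosen monotonically for each finite, and by suprema for each countable, set of points. Since the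
  bases are \<open>\<omega>\<close>-monotone, the base \<open>B S\<close> makes sense for an arbitrary set \<open>S\<close> of points as a union
  over the finite subsets of \<open>S\<close>, and together with \<open>K S\<close>, the union of the sets \<open>F\<close> over the countable
  subsets of \<open>S\<close>, it again defines a retraction \<open>retr S\<close> of \<open>X\<close> onto \<open>K S\<close>
  (\<open>full_c_skeleton_imp_point_skeleton\<close> and the locale \<open>point_skeleton\<close>). The crucial point is
  that \<open>K S\<close> is closed (\<open>closedin_K\<close>), a form of countable tightness.

  Induction on the cardinality of \<open>S\<close> then gives a family of continuous functions that separates the
  points of \<open>K S\<close> and of which only countably many are nonzero at any given point. For uncountable
  \<open>S\<close>, well-order \<open>S\<close> in the length of its cardinal and use the functions
  \<open>f \<circ> retr (under r a) - f \<circ> retr (underS r a)\<close>, with \<open>f\<close> from a family for the smaller set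
  \<open>under r a\<close>. They separate points because \<open>retr\<close> is continuous along increasing unions of sets
  (\<open>retr_chain_eq\<close>). Only countably many are nonzero at \<open>x\<close> because \<open>retr S x\<close> already
  belongs to \<open>K A\<close> for a countable \<open>A\<close>, so that the transfinite sequence of the points
  \<open>retr (underS r a) x\<close> becomes constant below every stage of uncountable cofinality and changes at
  countably many stages only (\<open>countable_jumps\<close>). For \<open>S = topspace X\<close> these functions are the
  coordinates of an embedding into a \<open>\<Sigma>\<close>-product.\<close>

section \<open>Directed families of sets\<close>

lemma compact_space_directed_Inter:
  assumes "compact_space X" and "I \<noteq> {}"
    and cl: "\<And>i. i \<in> I \<Longrightarrow> closedin X (C i)" and ne: "\<And>i. i \<in> I \<Longrightarrow> C i \<noteq> {}"
    and dir: "\<And>i j. i \<in> I \<Longrightarrow> j \<in> I \<Longrightarrow> \<exists>k\<in>I. C k \<subseteq> C i \<inter> C j"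
  shows "(\<Inter>i\<in>I. C i) \<noteq> {}"
proof -
  have lower: "\<exists>k\<in>I. \<forall>i\<in>J. C k \<subseteq> C i" if "finite J" "J \<subseteq> I" for J
    using that
  proof (induction J)
    case empty
    then show ?case using \<open>I \<noteq> {}\<close> by blast
  next
    case (insert i J)
    then obtain k where k: "k \<in> I" "\<forall>j\<in>J. C k \<subseteq> C j" by auto
    moreover from insert.prems k obtain l where "l \<in> I" "C l \<subseteq> C i \<inter> C k"
      using dir[of i k] by auto
    ultimately show ?case by (intro bexI[of _ l]) auto
  qed
  have "\<Inter>\<F> \<noteq> {}" if fin: "finite \<F>" and sub: "\<F> \<subseteq> C ` I" for \<F>
  proof -
    from finite_subset_image[OF fin sub] obtain J where J: "J \<subseteq> I" "finite J" "\<F> = C ` J"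
      by blast
    obtain k where "k \<in> I" "\<forall>i\<in>J. C k \<subseteq> C i" using lower J by blast
    then show ?thesis using ne[of k] J by blast
  qed
  moreover have "\<forall>D\<in>C ` I. closedin X D" using cl by blast
  ultimately show ?thesis
    using \<open>compact_space X\<close> unfolding compact_space_fip by (metis (no_types))
qed

lemma finite_subset_chain_UN:
  assumes "finite A" and "A \<subseteq> (\<Union>i\<in>I. D i)" and "I \<noteq> {}"
    and dir: "\<And>i j. i \<in> I \<Longrightarrow> j \<in> I \<Longrightarrow> D i \<subseteq> D j \<or> D j \<subseteq> D i"
  obtains i where "i \<in> I" and "A \<subseteq> D i"
proof -
  have "subset.chain UNIV (D ` I)"
    using dir by (auto simp: subset_chain_def)
  then obtain B where "B \<in> D ` I" "A \<subseteq> B"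
    using finite_subset_Union_chain[of A "D ` I"] assms(1-3) by blast
  then show ?thesis using that by blast
qed

section \<open>Pairs of points not separated by a family of open sets\<close>

text \<open>This relation need not be transitive. It is used in place of equality of all values of continuous
  functions because its complement is witnessed by two members of \<open>\<U>\<close>, so that it turns unions of chains of
  families into intersections.\<close>

definition unseparated :: "'a topology \<Rightarrow> 'a set set \<Rightarrow> ('a \<times> 'a) set" where
  "unseparated X \<U> = {(x, y) \<in> topspace X \<times> topspace X.
     \<forall>U\<in>\<U>. \<forall>V\<in>\<U>. x \<in> U \<longrightarrow> y \<in> V \<longrightarrow> U \<inter> V \<noteq> {}}"

lemma unseparated_refl: "x \<in> topspace X \<Longrightarrow> (x, x) \<in> unseparated X \<U>"
  unfolding unseparated_def by auto

lemma unseparated_antimono: "\<U> \<subseteq> \<V> \<Longrightarrow> unseparated X \<V> \<subseteq> unseparated X \<U>"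
  unfolding unseparated_def by auto

lemma closedin_unseparated:
  assumes op: "\<And>U. U \<in> \<U> \<Longrightarrow> openin X U"
  shows "closedin (prod_topology X X) (unseparated X \<U>)"
proof -
  have "topspace X \<times> topspace X - unseparated X \<U> =
      (\<Union>(U, V)\<in>{(U, V) \<in> \<U> \<times> \<U>. U \<inter> V = {}}. U \<times> V)"
    using openin_subset[OF op] by (auto simp: unseparated_def)
  moreover have "openin (prod_topology X X) \<dots>"
    by (intro openin_Union) (auto simp: openin_prod_Times_iff op)
  ultimately show ?thesis
    by (auto simp: closedin_def unseparated_def)
qed

section \<open>Skeletons indexed by sets of points\<close>

text \<open>A \<open>c\<close>-skeleton reindexed by sets of points. The family \<open>B S\<close> is determined by the finite subsets
  of \<open>S\<close> and the set \<open>K S\<close> by the countable ones, which allows \<open>S\<close> to be uncountable even though the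
  hypotheses on separation and density are about countable sets only. Of the
  continuous map into a Tychonoff space only the kernel matters: an equivalence relation that contains
  \<open>unseparated X (B A)\<close> and is trivial on \<open>K A\<close>.\<close>

locale point_skeleton =
  fixes X :: "'a topology" and B :: "'a set \<Rightarrow> 'a set set" and K :: "'a set \<Rightarrow> 'a set"
  assumes compact: "compact_space X"
    and tychonoff: "tychonoff_space X"
    and B_open: "U \<in> B S \<Longrightarrow> openin X U"
    and B_mono: "S \<subseteq> S' \<Longrightarrow> B S \<subseteq> B S'"
    and B_finitary: "U \<in> B S \<Longrightarrow> \<exists>F. finite F \<and> F \<subseteq> S \<and> U \<in> B F"
    and B_countable: "countable A \<Longrightarrow> countable (B A)"
    and B_cover: "x \<in> topspace X \<Longrightarrow> \<exists>U\<in>B S. x \<in> U"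
    and B_Int: "U \<in> B S \<Longrightarrow> V \<in> B S \<Longrightarrow> x \<in> U \<inter> V \<Longrightarrow> \<exists>W\<in>B S. x \<in> W \<and> W \<subseteq> U \<inter> V"
    and K_closed: "countable A \<Longrightarrow> closedin X (K A)"
    and K_eq: "K S = (\<Union>A\<in>{A. countable A \<and> A \<subseteq> S}. K A)"
    and K_point: "x \<in> topspace X \<Longrightarrow> x \<in> K {x}"
    and K_dense: "countable A \<Longrightarrow> U \<in> B A \<Longrightarrow> U \<noteq> {} \<Longrightarrow> U \<inter> K A \<noteq> {}"
    and K_separated: "countable A \<Longrightarrow>
      \<exists>g :: 'a \<Rightarrow> 'a. inj_on g (K A) \<and> (\<forall>(x, y)\<in>unseparated X (B A). g x = g y)"
begin

abbreviation E :: "'a set \<Rightarrow> ('a \<times> 'a) set" where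
  "E S \<equiv> unseparated X (B S)"

lemma Hausdorff: "Hausdorff_space X"
  using tychonoff by (simp add: tychonoff_space_def)

lemma E_antimono: "S \<subseteq> S' \<Longrightarrow> E S' \<subseteq> E S"
  by (intro unseparated_antimono B_mono)

lemma in_K_iff: "x \<in> K S \<longleftrightarrow> (\<exists>A. countable A \<and> A \<subseteq> S \<and> x \<in> K A)"
  by (subst K_eq) blast

lemma K_mono: "S \<subseteq> S' \<Longrightarrow> K S \<subseteq> K S'"
  by (rule subsetI) (metis in_K_iff subset_trans)

lemma in_KE:
  assumes "x \<in> K S"
  obtains A where "countable A" and "A \<subseteq> S" and "x \<in> K A"
  using assms in_K_iff[of x S] by metis

lemma K_topspace: "K S \<subseteq> topspace X"
proof
  fix x assume "x \<in> K S"
  then obtain A where "countable A" "x \<in> K A" by (rule in_KE)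
  then show "x \<in> topspace X" using closedin_subset[OF K_closed] by blast
qed

text \<open>The equivalence relation given by the map \<open>g\<close> for a countable part of \<open>S\<close> makes up for the missing
  transitivity of \<open>E S\<close>.\<close>

lemma chain_unique_in_K:
  assumes "y \<in> K S" and "z \<in> K S" and "(x, y) \<in> E S" and "(x, w) \<in> E S" and "(w, z) \<in> E S"
  shows "y = z"
proof -
  from assms obtain A A' where A: "countable A" "A \<subseteq> S" "y \<in> K A" "countable A'" "A' \<subseteq> S" "z \<in> K A'"
    by (metis in_KE)
  let ?C = "A \<union> A'"
  have C: "countable ?C" "y \<in> K ?C" "z \<in> K ?C" "E S \<subseteq> E ?C"
    using A K_mono[of A ?C] K_mono[of A' ?C] E_antimono[of ?C S] by auto
  obtain g :: "'a \<Rightarrow> 'a" where g: "inj_on g (K ?C)" "\<forall>(x, y)\<in>E ?C. g x = g y"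
    using K_separated[OF C(1)] by blast
  have "(x, y) \<in> E ?C" "(x, w) \<in> E ?C" "(w, z) \<in> E ?C" using assms C by auto
  then have "g y = g z" using g(2) by (metis (mono_tags, lifting) case_prodD)
  then show ?thesis using g(1) C by (meson inj_onD)
qed

lemma unique_in_K:
  assumes "y \<in> K S" and "z \<in> K S" and "(x, y) \<in> E S" and "(x, z) \<in> E S"
  shows "y = z"
proof (rule chain_unique_in_K[OF assms(1-3) _ assms(4)])
  show "(x, x) \<in> E S" using assms(3) by (auto simp: unseparated_def)
qed

text \<open>The closures of the neighbourhoods of \<open>x\<close> in \<open>B S\<close> have the finite intersection property on \<open>C\<close>,
  and a point common to all of them cannot be separated from \<open>x\<close>.\<close>

lemma adherent_unseparated:
  assumes x: "x \<in> topspace X" and C: "closedin X C"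
    and meets: "\<And>U. U \<in> B S \<Longrightarrow> x \<in> U \<Longrightarrow> U \<inter> C \<noteq> {}"
  obtains y where "y \<in> C" and "(x, y) \<in> E S"
proof -
  let ?I = "{U \<in> B S. x \<in> U}"
  have "(\<Inter>U\<in>?I. X closure_of U \<inter> C) \<noteq> {}"
  proof (rule compact_space_directed_Inter[OF compact])
    show "?I \<noteq> {}" using B_cover[OF x, of S] by blast
    show "closedin X (X closure_of U \<inter> C)" if "U \<in> ?I" for U
      using C by auto
    show "X closure_of U \<inter> C \<noteq> {}" if "U \<in> ?I" for U
    proof -
      have "U \<subseteq> X closure_of U"
        using that by (intro closure_of_subset openin_subset) (auto intro: B_open)
      then show ?thesis using that meets[of U] by blast
    qed
    show "\<exists>W\<in>?I. X closure_of W \<inter> C \<subseteq> (X closure_of U \<inter> C) \<inter> (X closure_of V \<inter> C)"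
      if UV: "U \<in> ?I" "V \<in> ?I" for U V
    proof -
      obtain W where W: "W \<in> ?I" "W \<subseteq> U \<inter> V"
        using B_Int[of U S V x] UV by blast
      then have "X closure_of W \<subseteq> X closure_of U" "X closure_of W \<subseteq> X closure_of V"
        by (auto intro!: closure_of_mono)
      then show ?thesis using W by blast
    qed
  qed
  then obtain y where "y \<in> (\<Inter>U\<in>?I. X closure_of U \<inter> C)" by (meson ex_in_conv)
  then have y: "y \<in> X closure_of U \<inter> C" if "U \<in> B S" "x \<in> U" for U
    using that by (simp split: if_splits)
  have "y \<in> C" using y B_cover[OF x, of S] by blast
  moreover have "U \<inter> V \<noteq> {}" if "U \<in> B S" "V \<in> B S" "x \<in> U" "y \<in> V" for U V
    using y[of U] that B_open[of V S] by (auto simp: in_closure_of)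
  ultimately show ?thesis
    using that x closedin_subset[OF C] by (auto simp: unseparated_def)
qed

lemma point_in_K:
  assumes "x \<in> topspace X" and "x \<in> S"
  shows "x \<in> K S"
  using K_point[OF assms(1)] K_mono[of "{x}" S] assms(2) by blast

text \<open>Let \<open>y\<close> be in the closure of \<open>K S\<close>. A closing-off argument of length \<open>\<omega>\<close> finds a countable
  \<open>L \<subseteq> S\<close> such that already \<open>K L\<close> meets every neighbourhood of \<open>y\<close> from \<open>B (insert y L)\<close>. Hence
  some point of \<open>K L\<close> is not separated from \<open>y\<close> by \<open>B (insert y L)\<close>. Both points lie in
  \<open>K (insert y L)\<close>, so they coincide.\<close>

lemma closedin_K: "closedin X (K S)"
proof -
  have "y \<in> K S" if y: "y \<in> X closure_of K S" for y
  proof -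
    have yX: "y \<in> topspace X" using y by (simp add: in_closure_of)
    have "\<exists>A'. countable A' \<and> A' \<subseteq> S \<and> A \<subseteq> A' \<and>
        (\<forall>U\<in>B (insert y A). y \<in> U \<longrightarrow> U \<inter> K A' \<noteq> {})" if A: "countable A" "A \<subseteq> S" for A
    proof -
      let ?W = "{U \<in> B (insert y A). y \<in> U}"
      have "\<exists>A'. countable A' \<and> A' \<subseteq> S \<and> U \<inter> K A' \<noteq> {}" if "U \<in> ?W" for U
      proof -
        obtain z where "z \<in> K S" "z \<in> U"
          using y B_open[of U "insert y A"] \<open>U \<in> ?W\<close> by (auto simp: in_closure_of)
        then show ?thesis by (metis in_KE disjoint_iff)
      qed
      then obtain N where N: "\<And>U. U \<in> ?W \<Longrightarrow> countable (N U) \<and> N U \<subseteq> S \<and> U \<inter> K (N U) \<noteq> {}"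
        by metis
      let ?A = "A \<union> (\<Union>U\<in>?W. N U)"
      have "countable ?A" using A N B_countable[of "insert y A"] by auto
      moreover have "U \<inter> K ?A \<noteq> {}" if "U \<in> ?W" for U
        using N[OF that] K_mono[of "N U" ?A] that by blast
      ultimately show ?thesis using A N by (intro exI[of _ ?A]) auto
    qed
    then obtain N where N: "\<And>A. countable A \<Longrightarrow> A \<subseteq> S \<Longrightarrow> countable (N A) \<and> N A \<subseteq> S \<and> A \<subseteq> N A \<and>
        (\<forall>U\<in>B (insert y A). y \<in> U \<longrightarrow> U \<inter> K (N A) \<noteq> {})"
      by metis
    \<comment> \<open>\<open>N A\<close> provides points for all neighbourhoods of \<open>y\<close> from \<open>B (insert y A)\<close>, but enlarges that
      family in turn. Hence the iteration.\<close>
    define A where "A n = (N ^^ n) {}" for n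
    have A: "countable (A n) \<and> A n \<subseteq> S" for n
      by (induction n) (use N in \<open>auto simp: A_def\<close>)
    have step: "A n \<subseteq> A (Suc n)" for n using N A by (simp add: A_def)
    then have inc: "A m \<subseteq> A n" if "m \<le> n" for m n
      using that by (rule lift_Suc_mono_le)
    define L where "L = (\<Union>n. A n)"
    have L: "countable L" "L \<subseteq> S" using A by (auto simp: L_def)
    have "U \<inter> K L \<noteq> {}" if U: "U \<in> B (insert y L)" "y \<in> U" for U
    proof -
      obtain F where F: "finite F" "F \<subseteq> insert y L" "U \<in> B F" using B_finitary[OF U(1)] by blast
      obtain n where "F - {y} \<subseteq> A n"
      proof (rule finite_subset_chain_UN[where A = "F - {y}" and I = UNIV and D = A])
        show "A i \<subseteq> A j \<or> A j \<subseteq> A i" for i j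
          using inc[of i j] inc[of j i] by (cases "i \<le> j") auto
      qed (use F in \<open>auto simp: L_def\<close>)
      then have "U \<in> B (insert y (A n))"
        using F(3) B_mono[of F "insert y (A n)"] by auto
      then have "U \<inter> K (A (Suc n)) \<noteq> {}"
        using N[of "A n"] A U(2) by (simp add: A_def)
      then show ?thesis
        using K_mono[of "A (Suc n)" L] by (auto simp: L_def)
    qed
    then obtain z where z: "z \<in> K L" "(y, z) \<in> E (insert y L)"
      using adherent_unseparated[OF yX K_closed[OF L(1)], of "insert y L"] by metis
    have "y = z"
    proof (rule unique_in_K)
      show "y \<in> K (insert y L)" using yX by (simp add: point_in_K)
      show "z \<in> K (insert y L)" using z(1) K_mono[of L "insert y L"] by blast
    qed (use z yX in \<open>auto intro: unseparated_refl\<close>)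
    then show ?thesis using z(1) K_mono[OF L(2)] by blast
  qed
  then show ?thesis
    using closure_of_subset_eq[of "K S" X] K_topspace[of S] by blast
qed


section \<open>The retractions of a skeleton\<close>

definition retr :: "'a set \<Rightarrow> 'a \<Rightarrow> 'a" where
  "retr S x = (THE y. y \<in> K S \<and> (x, y) \<in> E S)"

lemma retr:
  assumes x: "x \<in> topspace X"
  shows "retr S x \<in> K S" and "(x, retr S x) \<in> E S"
proof -
  have "U \<inter> K S \<noteq> {}" if U: "U \<in> B S" "x \<in> U" for U
  proof -
    obtain F where F: "finite F" "F \<subseteq> S" "U \<in> B F" using B_finitary[OF U(1)] by blast
    then have "U \<inter> K F \<noteq> {}" using K_dense[of F U] U(2) by (auto intro: countable_finite)
    then show ?thesis using K_mono[OF F(2)] by blast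
  qed
  then obtain y where y: "y \<in> K S" "(x, y) \<in> E S"
    using adherent_unseparated[OF x closedin_K[of S], of S] by metis
  have "\<exists>!y. y \<in> K S \<and> (x, y) \<in> E S"
  proof (rule ex1I)
    show "y \<in> K S \<and> (x, y) \<in> E S" using y by simp
    show "z = y" if "z \<in> K S \<and> (x, z) \<in> E S" for z
      by (rule unique_in_K[of z S y x]) (simp_all add: y that)
  qed
  from theI'[OF this] show "retr S x \<in> K S" and "(x, retr S x) \<in> E S"
    by (simp_all add: retr_def)
qed

lemma retr_topspace: "x \<in> topspace X \<Longrightarrow> retr S x \<in> topspace X"
  using retr(1)[of x S] K_topspace[of S] by blast

lemma retr_eqI: "x \<in> topspace X \<Longrightarrow> y \<in> K S \<Longrightarrow> (x, y) \<in> E S \<Longrightarrow> retr S x = y"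
  by (rule unique_in_K[of "retr S x" S y x]) (simp_all add: retr)

lemma retr_id: "x \<in> K S \<Longrightarrow> retr S x = x"
  using K_topspace[of S] retr_eqI[of x x S] unseparated_refl[of x X "B S"] by blast

lemma retr_retr:
  assumes "S \<subseteq> S'" and x: "x \<in> topspace X"
  shows "retr S (retr S' x) = retr S x"
proof (rule sym, rule chain_unique_in_K)
  show "(x, retr S' x) \<in> E S" using retr(2)[OF x] E_antimono[OF assms(1)] by blast
qed (simp_all add: x retr retr_topspace)

text \<open>The graph of \<open>retr S\<close> is closed, and projections along a compact factor are closed maps.\<close>

lemma continuous_map_retr: "continuous_map X X (retr S)"
  unfolding continuous_map_closedin
proof (intro conjI allI impI)
  show "retr S \<in> topspace X \<rightarrow> topspace X" by (simp add: retr_topspace)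
  fix C assume C: "closedin X C"
  have "closedin (prod_topology X X) (E S \<inter> topspace X \<times> (C \<inter> K S))"
    by (intro closedin_Int closedin_unseparated)
      (auto simp: closedin_prod_Times_iff C closedin_K intro: B_open)
  then have "closedin X (fst ` (E S \<inter> topspace X \<times> (C \<inter> K S)))"
    using closed_map_fst[OF compact, of X] by (simp add: closed_map_def)
  moreover have "fst ` (E S \<inter> topspace X \<times> (C \<inter> K S)) = {x \<in> topspace X. retr S x \<in> C}"
    by (auto simp: retr_eqI retr intro!: image_eqI[of _ fst "(x, retr S x)" for x])
  ultimately show "closedin X {x \<in> topspace X. retr S x \<in> C}" by simp
qed

text \<open>Continuity of \<open>retr\<close> along chains of sets: the points of \<open>K\<close> of the union that are separated neither
  from \<open>x\<close> nor from \<open>y\<close> at stage \<open>i\<close> form a closed set that decreases with the stage and contains the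
  common image of \<open>x\<close> and \<open>y\<close> at stage \<open>i\<close>. A point common to all these sets is the image under the
  limit retraction of \<open>x\<close> as well as of \<open>y\<close>.\<close>

lemma retr_chain_eq:
  assumes x: "x \<in> topspace X" and y: "y \<in> topspace X" and "I \<noteq> {}"
    and chain: "\<And>i j. i \<in> I \<Longrightarrow> j \<in> I \<Longrightarrow> D i \<subseteq> D j \<or> D j \<subseteq> D i"
    and eq: "\<And>i. i \<in> I \<Longrightarrow> retr (D i) x = retr (D i) y"
  shows "retr (\<Union>i\<in>I. D i) x = retr (\<Union>i\<in>I. D i) y"
proof -
  let ?S = "\<Union>i\<in>I. D i"
  define C where "C i = {p \<in> topspace X. (x, p) \<in> E (D i)} \<inter> {p \<in> topspace X. (y, p) \<in> E (D i)} \<inter> K ?S" for i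
  have C_anti: "C k \<subseteq> C i" if "D i \<subseteq> D k" for i k
    using E_antimono[OF that] by (auto simp: C_def)
  have cl: "closedin X {p \<in> topspace X. (z, p) \<in> E (D i)}" if "z \<in> topspace X" for z i
  proof -
    have "continuous_map X (prod_topology X X) (\<lambda>p. (z, p))"
      using that by (intro continuous_intros) auto
    moreover have "closedin (prod_topology X X) (E (D i))"
      by (intro closedin_unseparated B_open)
    ultimately show ?thesis by (rule closedin_continuous_map_preimage)
  qed
  have "(\<Inter>i\<in>I. C i) \<noteq> {}"
  proof (rule compact_space_directed_Inter[OF compact \<open>I \<noteq> {}\<close>])
    show "closedin X (C i)" for i
      unfolding C_def using x y by (intro closedin_Int cl closedin_K)
    show "C i \<noteq> {}" if "i \<in> I" for i
    proof -
      have "retr (D i) x \<in> K ?S"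
        using retr(1)[OF x] K_mono[of "D i" ?S] that by blast
      then have "retr (D i) x \<in> C i"
        using retr(2)[OF x, of "D i"] retr(2)[OF y, of "D i"] eq[OF that] retr_topspace[OF x, of "D i"]
        by (simp add: C_def)
      then show ?thesis by blast
    qed
    show "\<exists>k\<in>I. C k \<subseteq> C i \<inter> C j" if "i \<in> I" "j \<in> I" for i j
      using chain[OF that] C_anti[of i j] C_anti[of j i] that by blast
  qed
  then obtain p where p: "\<And>i. i \<in> I \<Longrightarrow> p \<in> C i" by blast
  have "(z, p) \<in> E ?S" if z: "z = x \<or> z = y" for z
  proof -
    have "U \<inter> V \<noteq> {}" if UV: "U \<in> B ?S" "V \<in> B ?S" "z \<in> U" "p \<in> V" for U V
    proof -
      obtain F G where F: "finite F" "F \<subseteq> ?S" "U \<in> B F" "finite G" "G \<subseteq> ?S" "V \<in> B G"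
        using B_finitary[OF UV(1)] B_finitary[OF UV(2)] by blast
      then obtain i where i: "i \<in> I" "F \<union> G \<subseteq> D i"
        using finite_subset_chain_UN[where A = "F \<union> G" and I = I and D = D] \<open>I \<noteq> {}\<close> chain by auto
      then have "U \<in> B (D i)" "V \<in> B (D i)"
        using F B_mono[of F "D i"] B_mono[of G "D i"] by auto
      then show ?thesis
        using p[OF i(1)] z UV(3,4) by (auto simp: C_def unseparated_def)
    qed
    moreover have "p \<in> topspace X" using p \<open>I \<noteq> {}\<close> by (auto simp: C_def)
    ultimately show ?thesis using x y z by (auto simp: unseparated_def)
  qed
  moreover have "p \<in> K ?S" using p \<open>I \<noteq> {}\<close> by (auto simp: C_def)
  ultimately show ?thesis using x y by (metis retr_eqI)
qed

section \<open>Point-countable separating families of functions\<close>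

definition separating_family :: "'a set \<Rightarrow> ('a \<Rightarrow> real) set \<Rightarrow> bool" where
  "separating_family S T \<longleftrightarrow>
     (\<forall>f\<in>T. continuous_map X euclideanreal f) \<and>
     (\<forall>x\<in>topspace X. countable {f \<in> T. f x \<noteq> 0}) \<and>
     (\<forall>x\<in>K S. \<forall>y\<in>K S. (\<forall>f\<in>T. f x = f y) \<longrightarrow> x = y)"

text \<open>For countable \<open>S\<close> the subspace \<open>K S\<close> is metrizable, and a countable family suffices: choose one
  function for each pair of members of \<open>B S\<close> that can be separated on \<open>K S\<close> by a continuous
  function.\<close>

lemma separating_family_countable:
  assumes S: "countable S"
  shows "\<exists>T. separating_family S T"
proof -
  define P where "P = {(U, V) \<in> B S \<times> B S. \<exists>f. continuous_map X euclideanreal f \<and>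
      (\<forall>p\<in>U \<inter> K S. f p < 1/2) \<and> (\<forall>p\<in>V \<inter> K S. f p > 1/2)}"
  have "\<forall>w\<in>P. \<exists>f. continuous_map X euclideanreal f \<and>
      (\<forall>p\<in>fst w \<inter> K S. f p < 1/2) \<and> (\<forall>p\<in>snd w \<inter> K S. f p > 1/2)"
    by (auto simp: P_def)
  then obtain h where h: "\<And>w. w \<in> P \<Longrightarrow> continuous_map X euclideanreal (h w) \<and>
      (\<forall>p\<in>fst w \<inter> K S. h w p < 1/2) \<and> (\<forall>p\<in>snd w \<inter> K S. h w p > 1/2)"
    by metis
  have cP: "countable P"
    by (rule countable_subset[of _ "B S \<times> B S"]) (auto simp: P_def B_countable S)
  \<comment> \<open>On \<open>K S\<close> the family \<open>B S\<close> contains arbitrarily small neighbourhoods of each point of \<open>K S\<close>.\<close>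
  have near: "\<exists>U\<in>B S. y \<in> U \<and> U \<inter> K S \<inter> C = {}" if "y \<in> K S" "closedin X C" "y \<notin> C" for y C
  proof (rule ccontr)
    assume "\<not> ?thesis"
    then have "\<And>U. U \<in> B S \<Longrightarrow> y \<in> U \<Longrightarrow> U \<inter> (K S \<inter> C) \<noteq> {}" by blast
    moreover have "closedin X (K S \<inter> C)" using that closedin_K by blast
    moreover have yX: "y \<in> topspace X" using that K_topspace by blast
    ultimately obtain z where "z \<in> K S \<inter> C" "(y, z) \<in> E S"
      using adherent_unseparated by metis
    then have "z = y"
      using unique_in_K[of z S y y] that(1) yX unseparated_refl by fastforce
    then show False using \<open>z \<in> K S \<inter> C\<close> that(3) by blast
  qed
  have "x = y" if xy: "x \<in> K S" "y \<in> K S" and eq: "\<forall>f\<in>h ` P. f x = f y" for x y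
  proof (rule ccontr)
    assume "x \<noteq> y"
    have "closedin X {y}" "x \<in> topspace X - {y}"
      using xy K_topspace Hausdorff \<open>x \<noteq> y\<close> by (auto intro: closedin_Hausdorff_singleton)
    then obtain f where f: "continuous_map X euclideanreal f" "f x = 0" "f ` {y} \<subseteq> {1}"
      using tychonoff unfolding tychonoff_space_def completely_regular_space_alt by metis
    have "closedin X {p \<in> topspace X. f p \<in> {1/2..}}" "closedin X {p \<in> topspace X. f p \<in> {..1/2}}"
      by (rule closedin_continuous_map_preimage[OF f(1)]; simp)+
    moreover have "x \<notin> {p \<in> topspace X. f p \<in> {1/2..}}" "y \<notin> {p \<in> topspace X. f p \<in> {..1/2}}"
      using f(2,3) by auto
    ultimately obtain U V where UV: "U \<in> B S" "x \<in> U" "V \<in> B S" "y \<in> V"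
      and U: "U \<inter> K S \<inter> {p \<in> topspace X. f p \<in> {1/2..}} = {}"
      and V: "V \<inter> K S \<inter> {p \<in> topspace X. f p \<in> {..1/2}} = {}"
      using near[OF xy(1)] near[OF xy(2)] by meson
    have "\<forall>p\<in>U \<inter> K S. f p < 1/2" "\<forall>p\<in>V \<inter> K S. f p > 1/2"
      using U V K_topspace[of S] by (force simp: not_le[symmetric])+
    then have "(U, V) \<in> P"
      using UV f(1) by (auto simp: P_def)
    moreover from this have "h (U, V) x = h (U, V) y" using eq by blast
    moreover have "h (U, V) x < 1/2" "h (U, V) y > 1/2"
      using h[OF \<open>(U, V) \<in> P\<close>] UV xy by simp_all
    ultimately show False by linarith
  qed
  then have "separating_family S (h ` P)"
    using h cP by (auto simp: separating_family_def intro: countable_subset[of _ "h ` P"])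
  then show ?thesis by blast
qed


text \<open>Suppose that \<open>x\<close> jumps uncountably often on \<open>I\<close>, but only countably often below each element of
  \<open>I\<close>. Then \<open>I\<close> has uncountable cofinality, so the countable set \<open>A \<subseteq> I\<close> with \<open>retr I x \<in> K A\<close> is
  bounded by some \<open>b \<in> I\<close>. Beyond \<open>b\<close> all values agree with \<open>retr I x\<close>, so that all jumps are
  at or below \<open>b\<close>.\<close>

lemma countable_jumps_initial_segment:
  assumes r: "Well_order r" and I: "I \<subseteq> Field r" and down: "\<And>a. a \<in> I \<Longrightarrow> underS r a \<subseteq> I"
    and x: "x \<in> topspace X"
    and below: "\<And>a. a \<in> I \<Longrightarrow> countable {b \<in> underS r a. retr (under r b) x \<noteq> retr (underS r b) x}"
  shows "countable {b \<in> I. retr (under r b) x \<noteq> retr (underS r b) x}"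
proof (rule ccontr)
  define J where "J = {b. retr (under r b) x \<noteq> retr (underS r b) x}"
  assume "\<not> ?thesis"
  then have unc: "\<not> countable (I \<inter> J)" by (simp add: J_def Int_def)
  have below': "countable (underS r a \<inter> J)" if "a \<in> I" for a
    using below[OF that] by (simp add: J_def Int_def)
  have under_eq: "under r a = insert a (underS r a)" if "a \<in> I" for a
    using Refl_under_underS[of r a] r I that
    by (auto simp: well_order_on_def linear_order_on_def partial_order_on_def preorder_on_def)
  have lin: "b \<in> under r a \<or> under r a \<subseteq> underS r b" if "a \<in> I" "b \<in> I" for a b
  proof -
    have "Total r" "Refl r" "trans r" "antisym r"
      using r by (auto simp: well_order_on_def linear_order_on_def partial_order_on_def preorder_on_def)
    then have ab: "(a, b) \<in> r" if "(b, a) \<notin> r"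
      using that I \<open>a \<in> I\<close> \<open>b \<in> I\<close> by (cases "a = b") (auto simp: total_on_def refl_on_def)
    have "c \<in> underS r b" if "(b, a) \<notin> r" "c \<in> under r a" for c
      using that transD[OF \<open>trans r\<close> _ ab, of c] by (auto simp: under_def underS_def)
    then show ?thesis by (auto simp: under_def)
  qed
  obtain A where A: "countable A" "A \<subseteq> I" "retr I x \<in> K A"
    using retr(1)[OF x, of I] by (rule in_KE)
  \<comment> \<open>Otherwise \<open>I\<close> would be a countable union of initial segments with countably many jumps each.\<close>
  have "\<exists>b\<in>I. A \<subseteq> under r b"
  proof (rule ccontr)
    assume no: "\<not> ?thesis"
    have "I \<inter> J \<subseteq> (\<Union>a\<in>A. underS r a \<inter> J)"
    proof
      fix b assume b: "b \<in> I \<inter> J"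
      then obtain a where a: "a \<in> A" "a \<notin> under r b" using no by blast
      then have "under r b \<subseteq> underS r a" using lin[of b a] b A(2) by blast
      then have "b \<in> underS r a" using under_eq[of b] b by auto
      then show "b \<in> (\<Union>a\<in>A. underS r a \<inter> J)" using a b by blast
    qed
    moreover have "countable (\<Union>a\<in>A. underS r a \<inter> J)" using A below' by blast
    ultimately show False using unc countable_subset by blast
  qed
  then obtain b where b: "b \<in> I" "A \<subseteq> under r b" by blast
  have "I \<inter> J \<subseteq> insert b (underS r b \<inter> J)"
  proof
    fix a assume a: "a \<in> I \<inter> J"
    have stable: "retr S x = retr I x" if "A \<subseteq> S" "S \<subseteq> I" for S
    proof -
      have "retr S x = retr S (retr I x)" using retr_retr[OF that(2) x] by simp
      also have "\<dots> = retr I x" using A(3) K_mono[OF that(1)] by (intro retr_id) blast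
      finally show ?thesis .
    qed
    have "a \<in> under r b"
    proof (rule ccontr)
      assume "a \<notin> under r b"
      then have sub: "under r b \<subseteq> underS r a" using lin[of b a] a b by blast
      then have "A \<subseteq> underS r a" "A \<subseteq> under r a" using b under_eq[of a] a by auto
      then have "retr (underS r a) x = retr I x" "retr (under r a) x = retr I x"
        using down[of a] a under_eq[of a] by (auto intro!: stable)
      then show False using a by (simp add: J_def)
    qed
    then show "a \<in> insert b (underS r b \<inter> J)" using under_eq[OF b(1)] a by auto
  qed
  moreover have "countable (insert b (underS r b \<inter> J))" using below'[OF b(1)] by simp
  ultimately show False using unc countable_subset by blast
qed

lemma countable_jumps:
  assumes r: "Well_order r" and x: "x \<in> topspace X"
  shows "countable {b \<in> Field r. retr (under r b) x \<noteq> retr (underS r b) x}"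
proof -
  have tr: "trans r" "antisym r" "wf (r - Id)"
    using r by (auto simp: well_order_on_def linear_order_on_def partial_order_on_def preorder_on_def)
  have below: "countable {b \<in> underS r a. retr (under r b) x \<noteq> retr (underS r b) x}" for a
  proof (induction a rule: wf_induct_rule[OF tr(3)])
    case (1 a)
    show ?case
    proof (rule countable_jumps_initial_segment[OF r Order_Relation.underS_Field _ x])
      show "underS r b \<subseteq> underS r a" if "b \<in> underS r a" for b
        using that tr by (auto simp: underS_def dest: transD antisymD)
      show "countable {c \<in> underS r b. retr (under r c) x \<noteq> retr (underS r c) x}"
        if "b \<in> underS r a" for b
        using 1[of b] that by (auto simp: underS_def)
    qed
  qed
  show ?thesis
    by (rule countable_jumps_initial_segment[OF r order.refl Order_Relation.underS_Field x below])
qed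

text \<open>Telescoping: the differences at stage \<open>a\<close> detect whether \<open>x\<close> and \<open>y\<close>, having the same image under
  \<open>retr (underS r a)\<close>, still have the same image under \<open>retr (under r a)\<close>, and vanish at points that
  do not jump at \<open>a\<close>. The retraction to \<open>K {}\<close> starts the induction.\<close>

lemma separating_family_glue:
  assumes r: "Well_order r" and step: "\<And>a. a \<in> Field r \<Longrightarrow> \<exists>T. separating_family (under r a) T"
  shows "\<exists>T. separating_family (Field r) T"
proof -
  obtain T where T: "\<And>a. a \<in> Field r \<Longrightarrow> separating_family (under r a) (T a)"
    using step by metis
  obtain T0 where T0: "separating_family {} T0"
    using separating_family_countable[of "{}"] by auto
  define h where "h f = f \<circ> retr {}" for f :: "'a \<Rightarrow> real"
  define g where "g a f x = f (retr (under r a) x) - f (retr (underS r a) x)"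
    for a and f :: "'a \<Rightarrow> real" and x
  define TT where "TT = h ` T0 \<union> (\<Union>a\<in>Field r. g a ` T a)"
  have rr: "Refl r" "trans r" "antisym r" "Total r" "wf (r - Id)"
    using r by (auto simp: well_order_on_def linear_order_on_def partial_order_on_def preorder_on_def)
  have under_chain: "under r a \<subseteq> under r b \<or> under r b \<subseteq> under r a" if "a \<in> Field r" "b \<in> Field r" for a b
  proof -
    have "(a, b) \<in> r \<or> (b, a) \<in> r" using that rr(1,4) by (cases "a = b") (auto simp: total_on_def refl_on_def)
    then show ?thesis unfolding under_def by (auto intro: transD[OF rr(2)])
  qed
  have underS_UN: "underS r a = (\<Union>b\<in>underS r a. under r b)" for a
  proof
    show "underS r a \<subseteq> (\<Union>b\<in>underS r a. under r b)"
      using rr(1) by (auto simp: underS_def under_def refl_on_def Field_def)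
    show "(\<Union>b\<in>underS r a. under r b) \<subseteq> underS r a"
      by (auto simp: underS_def under_def intro: transD[OF rr(2)] dest: antisymD[OF rr(3)])
  qed
  have Field_UN: "Field r = (\<Union>b\<in>Field r. under r b)"
    using rr(1) by (auto simp: under_def refl_on_def Field_def)
  have "continuous_map X euclideanreal f" if "f \<in> TT" for f
  proof -
    have cr: "continuous_map X euclideanreal (\<lambda>x. u (retr S x))" if "continuous_map X euclideanreal u" for u S
      using continuous_map_compose[OF continuous_map_retr that] by (simp add: o_def)
    have "continuous_map X euclideanreal (h u)" if "u \<in> T0" for u
      using cr[of u] that T0 by (simp add: h_def o_def separating_family_def)
    moreover have "continuous_map X euclideanreal (g a u)" if "a \<in> Field r" "u \<in> T a" for a u
      unfolding g_def using cr[of u] that T[OF that(1)]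
      by (intro continuous_map_diff) (auto simp: separating_family_def)
    ultimately show ?thesis using that by (auto simp: TT_def)
  qed
  moreover have "countable {f \<in> TT. f x \<noteq> 0}" if x: "x \<in> topspace X" for x
  proof -
    define J where "J = {b \<in> Field r. retr (under r b) x \<noteq> retr (underS r b) x}"
    define N where "N a S = {f \<in> T a. f (retr S x) \<noteq> 0}" for a S
    have J: "countable J" unfolding J_def by (rule countable_jumps[OF r x])
    have N: "countable (N a S)" if "a \<in> J" for a S
      using T[of a] that retr_topspace[OF x, of S] by (auto simp: N_def J_def separating_family_def)
    have "{f \<in> TT. f x \<noteq> 0} \<subseteq> h ` {f \<in> T0. f (retr {} x) \<noteq> 0} \<union>
        (\<Union>a\<in>J. g a ` (N a (under r a) \<union> N a (underS r a)))"
      by (auto simp: TT_def h_def g_def J_def N_def)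
    moreover have "countable \<dots>"
      using J N T0 retr_topspace[OF x, of "{}"] by (auto simp: separating_family_def)
    ultimately show ?thesis by (rule countable_subset)
  qed
  moreover have "x = y" if K: "x \<in> K (Field r)" "y \<in> K (Field r)" and eq: "\<forall>f\<in>TT. f x = f y" for x y
  proof -
    have xy: "x \<in> topspace X" "y \<in> topspace X" using K K_topspace[of "Field r"] by auto
    have base: "retr {} x = retr {} y"
    proof -
      have "f (retr {} x) = f (retr {} y)" if "f \<in> T0" for f
        using bspec[OF eq, of "h f"] that by (simp add: TT_def h_def)
      then show ?thesis using T0 retr(1)[OF xy(1)] retr(1)[OF xy(2)] by (simp add: separating_family_def)
    qed
    have levels: "retr (under r a) x = retr (under r a) y" if "a \<in> Field r" for a
      using that
    proof (induction a rule: wf_induct_rule[OF rr(5)])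
      case (1 a)
      have lower: "retr (underS r a) x = retr (underS r a) y"
      proof (cases "underS r a = {}")
        case False
        have "retr (\<Union>b\<in>underS r a. under r b) x = retr (\<Union>b\<in>underS r a. under r b) y"
        proof (rule retr_chain_eq[OF xy False])
          show "retr (under r b) x = retr (under r b) y" if "b \<in> underS r a" for b
            using 1(1)[of b] that Order_Relation.underS_Field[of r a] by (auto simp: underS_def)
        qed (use under_chain Order_Relation.underS_Field[of r a] in blast)
        then show ?thesis using underS_UN[of a] by simp
      qed (simp add: base)
      have "f (retr (under r a) x) = f (retr (under r a) y)" if "f \<in> T a" for f
        using bspec[OF eq, of "g a f"] that 1(2) lower by (auto simp: TT_def g_def)
      then show ?case
        using T[OF 1(2)] retr(1)[OF xy(1)] retr(1)[OF xy(2)] by (simp add: separating_family_def)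
    qed
    have "retr (Field r) x = retr (Field r) y"
    proof (cases "Field r = {}")
      case False
      have "retr (\<Union>b\<in>Field r. under r b) x = retr (\<Union>b\<in>Field r. under r b) y"
        by (rule retr_chain_eq[OF xy False under_chain levels])
      then show ?thesis using Field_UN by simp
    qed (simp add: base)
    then show ?thesis using K by (simp add: retr_id)
  qed
  ultimately have "separating_family (Field r) TT" by (simp add: separating_family_def)
  then show ?thesis by blast
qed

text \<open>An infinite cardinal is a limit ordinal. Therefore not only the sets \<open>underS r a\<close> but also the
  sets \<open>under r a\<close> are smaller than \<open>S\<close>.\<close>

lemma ex_separating_family: "\<exists>T. separating_family S T"
proof (induction S rule: wf_induct_rule[OF wf_inv_image[OF wf_ordLess, of card_of]])
  case (1 S)
  show ?case
  proof (cases "countable S")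
    case True
    then show ?thesis by (rule separating_family_countable)
  next
    case False
    let ?r = "card_of S"
    have co: "Card_order ?r" by (rule card_of_Card_order)
    have F: "Field ?r = S" by (rule Field_card_of)
    have "infinite (Field ?r)" using False F by (auto intro: countable_finite)
    have "\<exists>T. separating_family (under ?r a) T" if a: "a \<in> Field ?r" for a
    proof -
      obtain b where b: "b \<in> Field ?r" "a \<noteq> b" "(a, b) \<in> ?r"
        using infinite_Card_order_limit[OF co \<open>infinite (Field ?r)\<close> a] by blast
      have "trans ?r" "antisym ?r"
        using co by (auto simp: card_order_on_def well_order_on_def linear_order_on_def
            partial_order_on_def preorder_on_def)
      then have "under ?r a \<subseteq> underS ?r b"
        using b by (auto simp: under_def underS_def dest: transD antisymD)
      then have "(card_of (under ?r a), ?r) \<in> ordLess"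
        using card_of_underS[OF co b(1)] card_of_mono1 ordLeq_ordLess_trans by blast
      then show ?thesis by (intro 1) simp
    qed
    then have "\<exists>T. separating_family (Field ?r) T"
      by (rule separating_family_glue[OF card_of_Well_order])
    then show ?thesis using F by simp
  qed
qed

theorem corson_space_of_skeleton: "corson_space X"
proof -
  obtain T where "separating_family (topspace X) T" using ex_separating_family by blast
  then have T: "\<And>f. f \<in> T \<Longrightarrow> continuous_map X euclideanreal f"
      "\<And>x. x \<in> topspace X \<Longrightarrow> countable {f \<in> T. f x \<noteq> 0}"
      "\<And>x y. x \<in> topspace X \<Longrightarrow> y \<in> topspace X \<Longrightarrow> \<forall>f\<in>T. f x = f y \<Longrightarrow> x = y"
    by (auto simp: separating_family_def point_in_K)
  define \<phi> where "\<phi> x = (\<lambda>f\<in>T. f x)" for x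
  have cont: "continuous_map X (powertop_real T) \<phi>"
    unfolding continuous_map_componentwise \<phi>_def by (auto simp: T(1))
  have "embedding_map X (powertop_real T) \<phi>"
  proof (rule injective_closed_imp_embedding_map[OF cont])
    show "closed_map X (powertop_real T) \<phi>"
      by (intro continuous_imp_closed_map_gen[OF compact _ cont] Hausdorff_imp_kc_space)
        (simp add: Hausdorff_space_product_topology)
    have "x = y" if "x \<in> topspace X" "y \<in> topspace X" "\<phi> x = \<phi> y" for x y
    proof (rule T(3)[OF that(1,2)], rule ballI)
      fix f assume "f \<in> T"
      then show "f x = f y" using fun_cong[OF that(3), of f] by (simp add: \<phi>_def)
    qed
    then show "inj_on \<phi> (topspace X)" by (intro inj_onI)
  qed
  moreover have "\<phi> x \<in> sigma_product T" if "x \<in> topspace X" for x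
  proof -
    have "{f \<in> T. \<phi> x f \<noteq> 0} = {f \<in> T. f x \<noteq> 0}" by (auto simp: \<phi>_def)
    then show ?thesis using T(2)[OF that] by (simp add: sigma_product_def \<phi>_def)
  qed
  ultimately show ?thesis
    using compact by (intro corson_spaceI[of X T \<phi>]) (auto simp: corson_embedding_def)
qed

end

section \<open>Monotone choices in up-directed \<open>\<sigma>\<close>-complete orders\<close>

lemma countable_upper_bound:
  assumes dsc: "directed_sigma_complete \<Gamma> r" and "\<Gamma> \<noteq> {}" and C: "countable C" "C \<subseteq> \<Gamma>"
  obtains u where "u \<in> \<Gamma>" and "\<And>c. c \<in> C \<Longrightarrow> (c, u) \<in> r"
proof (cases "C = {}")
  case True
  then show ?thesis using that \<open>\<Gamma> \<noteq> {}\<close> by blast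
next
  case False
  let ?c = "from_nat_into C"
  have c: "?c n \<in> \<Gamma>" for n using from_nat_into[OF False] C by blast
  have "\<exists>\<sigma>. \<forall>n. \<sigma> n \<in> \<Gamma> \<and> ((\<sigma> n, \<sigma> (Suc n)) \<in> r \<and> (?c n, \<sigma> (Suc n)) \<in> r)"
  proof (rule dependent_nat_choice)
    show "\<exists>x. x \<in> \<Gamma>" using \<open>\<Gamma> \<noteq> {}\<close> by blast
    show "\<exists>y. y \<in> \<Gamma> \<and> (x, y) \<in> r \<and> (?c n, y) \<in> r" if "x \<in> \<Gamma>" for x n
      using dsc that c[of n] unfolding directed_sigma_complete_def by meson
  qed
  then obtain \<sigma> where \<sigma>: "\<And>n. \<sigma> n \<in> \<Gamma>" "\<And>n. (\<sigma> n, \<sigma> (Suc n)) \<in> r" "\<And>n. (?c n, \<sigma> (Suc n)) \<in> r"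
    by blast
  then have "increasing_sequence \<Gamma> r \<sigma>" by (simp add: increasing_sequence_def)
  then obtain u where u: "is_supremum \<Gamma> r (range \<sigma>) u"
    using dsc unfolding directed_sigma_complete_def by blast
  show ?thesis
  proof (rule that)
    show "u \<in> \<Gamma>" using u by (simp add: is_supremum_def)
    fix d assume "d \<in> C"
    then obtain n where "d = ?c n" using C(1) by (metis from_nat_into_to_nat_on)
    moreover have "(\<sigma> (Suc n), u) \<in> r" using u by (simp add: is_supremum_def)
    moreover have "trans r" using dsc by (simp add: directed_sigma_complete_def partial_order_on_def preorder_on_def)
    ultimately show "(d, u) \<in> r" using \<sigma>(3)[of n] by (metis transD)
  qed
qed

text \<open>Recursion over proper inclusion: the finitely many choices for the proper subsets of \<open>A\<close> have a
  common upper bound. The map \<open>i\<close> prescribes lower bounds for the choices.\<close>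

lemma monotone_choice_finite_sets:
  fixes i :: "'a \<Rightarrow> 's"
  assumes dsc: "directed_sigma_complete \<Gamma> r" and i: "\<forall>x. i x \<in> \<Gamma>"
    and cofinal: "\<forall>s\<in>\<Gamma>. \<exists>t\<in>\<Gamma>. P t \<and> (s, t) \<in> r"
  shows "\<exists>v. \<forall>A. finite A \<longrightarrow> v A \<in> \<Gamma> \<and> P (v A) \<and> (\<forall>x\<in>A. (i x, v A) \<in> r) \<and>
    (\<forall>A'\<subseteq>A. (v A', v A) \<in> r)"
proof -
  have tr: "trans r" and rf: "refl_on \<Gamma> r"
    using dsc by (simp_all add: directed_sigma_complete_def partial_order_on_def preorder_on_def)
  have ne: "\<Gamma> \<noteq> {}" using i by blast
  let ?Q = "\<lambda>v A s. finite A \<longrightarrow> s \<in> \<Gamma> \<and> P s \<and> (\<forall>A'. A' \<subset> A \<longrightarrow> (v A', s) \<in> r) \<and> (\<forall>x\<in>A. (i x, s) \<in> r)"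
  have "\<exists>v. \<forall>A. ?Q v A (v A)"
  proof (rule dependent_wf_choice[OF wf_finite_psubset])
    fix f g :: "'a set \<Rightarrow> 's" and A s
    assume "\<And>A'. (A', A) \<in> finite_psubset \<Longrightarrow> f A' = g A'"
    then have "f A' = g A'" if "finite A" "A' \<subset> A" for A'
      using that by (simp add: finite_psubset_def)
    then show "?Q f A s = ?Q g A s"
      by (cases "finite A") (simp_all cong: imp_cong)
  next
    fix A :: "'a set" and f :: "'a set \<Rightarrow> 's"
    assume IH: "\<And>A'. (A', A) \<in> finite_psubset \<Longrightarrow> ?Q f A' (f A')"
    show "\<exists>s. ?Q f A s"
    proof (cases "finite A")
      case True
      let ?C = "f ` {A'. A' \<subset> A} \<union> i ` A"
      have "f A' \<in> \<Gamma>" if "A' \<subset> A" for A'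
        using IH[of A'] that True finite_subset[of A' A] by (auto simp: finite_psubset_def)
      then have C: "?C \<subseteq> \<Gamma>" using i by auto
      have "finite {A'. A' \<subset> A}" by (rule finite_subset[of _ "Pow A"]) (use True in auto)
      then have "countable ?C" using True by (intro countable_finite) simp
      then obtain t where t: "t \<in> \<Gamma>" "\<And>c. c \<in> ?C \<Longrightarrow> (c, t) \<in> r"
        using countable_upper_bound[OF dsc ne _ C] by metis
      obtain s where s: "s \<in> \<Gamma>" "P s" "(t, s) \<in> r" using bspec[OF cofinal t(1)] by blast
      have "(c, s) \<in> r" if "c \<in> ?C" for c using transD[OF tr t(2)[OF that] s(3)] .
      then show ?thesis using s(1,2) by blast
    qed simp
  qed
  then obtain v where v0: "\<forall>A. ?Q v A (v A)" ..
  have v: "v A \<in> \<Gamma>" "P (v A)" "\<And>A'. A' \<subset> A \<Longrightarrow> (v A', v A) \<in> r" "\<And>x. x \<in> A \<Longrightarrow> (i x, v A) \<in> r"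
    if "finite A" for A
    using v0[rule_format, OF that] by simp_all
  have "(v A', v A) \<in> r" if "finite A" "A' \<subseteq> A" for A A'
  proof (cases "A' = A")
    case True
    then show ?thesis
      using v(1)[OF that(1)] refl_onD[OF rf] by simp
  next
    case False
    then show ?thesis using v(3)[OF that(1), of A'] that(2) by blast
  qed
  then show ?thesis using v by (intro exI[of _ v]) simp
qed

text \<open>An enumeration exhausts a countable set by an increasing sequence of finite sets, along which the
  monotone choice for finite sets has a supremum. Every finite subset is contained in a member of this
  sequence, so the supremum is an upper bound of the choices for all finite subsets, and monotonicity
  follows. The last clause lets \<open>\<omega>\<close>-monotone maps be computed from finite sets.\<close>

lemma monotone_choice_countable_sets:
  fixes i :: "'a \<Rightarrow> 's"
  assumes dsc: "directed_sigma_complete \<Gamma> r" and i: "\<forall>x. i x \<in> \<Gamma>"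
    and cofinal: "\<forall>s\<in>\<Gamma>. \<exists>t\<in>\<Gamma>. P t \<and> (s, t) \<in> r"
    and P_sup: "\<forall>\<sigma> s. increasing_sequence \<Gamma> r \<sigma> \<longrightarrow> (\<forall>n. P (\<sigma> n)) \<longrightarrow>
      is_supremum \<Gamma> r (range \<sigma>) s \<longrightarrow> P s"
  shows "\<exists>u. \<forall>A. countable A \<longrightarrow> u A \<in> \<Gamma> \<and> P (u A) \<and> (\<forall>x\<in>A. (i x, u A) \<in> r) \<and>
    (\<forall>A'\<subseteq>A. (u A', u A) \<in> r) \<and>
    (\<exists>\<alpha>. (\<forall>n. finite (\<alpha> n) \<and> \<alpha> n \<subseteq> A) \<and>
      increasing_sequence \<Gamma> r (u \<circ> \<alpha>) \<and> is_supremum \<Gamma> r (range (u \<circ> \<alpha>)) (u A))"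
proof -
  have tr: "trans r"
    using dsc by (simp add: directed_sigma_complete_def partial_order_on_def preorder_on_def)
  obtain v where v0: "\<forall>A. finite A \<longrightarrow> v A \<in> \<Gamma> \<and> P (v A) \<and> (\<forall>x\<in>A. (i x, v A) \<in> r) \<and>
      (\<forall>A'\<subseteq>A. (v A', v A) \<in> r)"
    using monotone_choice_finite_sets[OF dsc i cofinal] by (rule exE)
  have v: "v A \<in> \<Gamma>" "P (v A)" "\<And>x. x \<in> A \<Longrightarrow> (i x, v A) \<in> r"
      "\<And>A'. A' \<subseteq> A \<Longrightarrow> (v A', v A) \<in> r" if "finite A" for A
    using v0[rule_format, OF that] by simp_all
  define seg where "seg A n = {x \<in> A. to_nat_on A x < n}" for A :: "'a set" and n
  have seg: "finite (seg A n)" if "countable A" for A n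
  proof (rule finite_imageD)
    show "finite (to_nat_on A ` seg A n)"
      by (rule finite_subset[of _ "{..<n}"]) (auto simp: seg_def)
    show "inj_on (to_nat_on A) (seg A n)"
      using inj_on_to_nat_on[OF that] by (rule inj_on_subset) (auto simp: seg_def)
  qed
  have seg_mono: "seg A m \<subseteq> seg A n" if "m \<le> n" for A m n
    using that by (auto simp: seg_def)
  have seg_sub: "seg A n \<subseteq> A" for A n by (auto simp: seg_def)
  have seg_cofinal: "\<exists>n. A' \<subseteq> seg A n" if "finite A'" "A' \<subseteq> A" for A A'
  proof -
    have "A' \<subseteq> seg A (Suc (Max (to_nat_on A ` A')))"
      using that by (auto simp: seg_def less_Suc_eq_le)
    then show ?thesis by blast
  qed
  have inc: "increasing_sequence \<Gamma> r (\<lambda>n. v (seg A n))" if "countable A" for A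
    using v(1)[OF seg[OF that]] v(4)[OF seg[OF that] seg_mono[of _ "Suc _"]]
    by (simp add: increasing_sequence_def)
  have sup: "\<exists>u. is_supremum \<Gamma> r (range \<sigma>) u" if "increasing_sequence \<Gamma> r \<sigma>" for \<sigma>
    using dsc that by (simp add: directed_sigma_complete_def)
  define u where "u A = (SOME s. is_supremum \<Gamma> r (range (\<lambda>n. v (seg A n))) s)" for A
  have u: "is_supremum \<Gamma> r (range (\<lambda>n. v (seg A n))) (u A)" if "countable A" for A
    using someI_ex[OF sup[OF inc[OF that]]] by (simp add: u_def)
  have u\<Gamma>: "u A \<in> \<Gamma>" "P (u A)" if "countable A" for A
    using u[OF that] P_sup[rule_format, OF inc[OF that] v(2)[OF seg[OF that]] u[OF that]]
    by (auto simp: is_supremum_def)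
  have vu: "(v A', u A) \<in> r" if A: "countable A" and A': "finite A'" "A' \<subseteq> A" for A A'
  proof -
    obtain n where "A' \<subseteq> seg A n" using seg_cofinal[OF A'] by blast
    then have "(v A', v (seg A n)) \<in> r" by (intro v(4) seg A)
    moreover have "(v (seg A n), u A) \<in> r" using u[OF A] by (simp add: is_supremum_def)
    ultimately show ?thesis by (rule transD[OF tr])
  qed
  have u_mono: "(u A', u A) \<in> r" if A: "countable A" "A' \<subseteq> A" for A A'
  proof -
    have A': "countable A'" using A countable_subset by blast
    have "(v (seg A' n), u A) \<in> r" for n
      using vu[OF A(1) seg[OF A']] seg_sub[of A' n] A(2) by blast
    then show ?thesis using u[OF A'] u\<Gamma>(1)[OF A(1)] by (auto simp: is_supremum_def)
  qed
  have "(i x, u A) \<in> r" if "countable A" "x \<in> A" for A x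
    using transD[OF tr v(3)[of "{x}" x] vu[OF that(1), of "{x}"]] that by simp
  moreover have "\<exists>\<alpha>. (\<forall>n. finite (\<alpha> n) \<and> \<alpha> n \<subseteq> A) \<and>
      increasing_sequence \<Gamma> r (u \<circ> \<alpha>) \<and> is_supremum \<Gamma> r (range (u \<circ> \<alpha>)) (u A)"
    if A: "countable A" for A
  proof (intro exI conjI allI)
    have cs: "countable (seg A n)" for n by (intro countable_finite seg A)
    show "finite (seg A n)" "seg A n \<subseteq> A" for n by (fact seg[OF A] seg_sub)+
    show "increasing_sequence \<Gamma> r (u \<circ> seg A)"
      using u\<Gamma>(1)[OF cs] u_mono[OF cs seg_mono[of _ "Suc _"]] by (simp add: increasing_sequence_def)
    have "(u A, w) \<in> r" if w: "w \<in> \<Gamma>" "\<And>n. (u (seg A n), w) \<in> r" for w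
    proof -
      have "(v (seg A n), w) \<in> r" for n
        using transD[OF tr vu[OF cs seg[OF A] order.refl] w(2)] .
      then show ?thesis using u[OF A] w(1) by (auto simp: is_supremum_def)
    qed
    then show "is_supremum \<Gamma> r (range (u \<circ> seg A)) (u A)"
      using u\<Gamma>(1)[OF A] u_mono[OF A seg_sub] by (auto simp: is_supremum_def)
  qed
  ultimately show ?thesis
    using u\<Gamma> u_mono by (intro exI[of _ u]) simp
qed

section \<open>Reindexing a \<open>c\<close>-skeleton by sets of points\<close>

definition dense_index :: "('s \<Rightarrow> 'a set) \<Rightarrow> ('s \<Rightarrow> 'a set set) \<Rightarrow> 's \<Rightarrow> bool" where
  "dense_index F \<B> s \<longleftrightarrow> (\<forall>U\<in>\<B> s. U \<noteq> {} \<longrightarrow> U \<inter> F s \<noteq> {})"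

lemma dense_index_supremum:
  assumes skel: "c_skeleton X \<Gamma> r F \<B>"
    and inc: "increasing_sequence \<Gamma> r \<sigma>" and u: "is_supremum \<Gamma> r (range \<sigma>) u"
    and meets: "\<And>n U. U \<in> \<B> (\<sigma> n) \<Longrightarrow> U \<noteq> {} \<Longrightarrow> \<exists>m. U \<inter> F (\<sigma> m) \<noteq> {}"
  shows "dense_index F \<B> u"
  unfolding dense_index_def
proof (intro ballI impI)
  note sk = c_skeletonD[OF skel]
  fix U assume U: "U \<in> \<B> u" "U \<noteq> {}"
  obtain n where "U \<in> \<B> (\<sigma> n)" using U(1) sk(9)[OF inc u] by blast
  then obtain m where "U \<inter> F (\<sigma> m) \<noteq> {}" using meets U(2) by blast
  moreover have "\<sigma> m \<in> \<Gamma>" "u \<in> \<Gamma>" "(\<sigma> m, u) \<in> r"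
    using inc u by (auto simp: increasing_sequence_def is_supremum_def)
  ultimately show "U \<inter> F u \<noteq> {}" using sk(7)[of "\<sigma> m" u] by blast
qed

text \<open>For each nonempty member of the countable family \<open>\<B> s\<close> choose one of its points, and an index above
  \<open>s\<close> whose closed set contains all the chosen points. The supremum of \<open>\<omega>\<close> many such steps works,
  since its base is the union of the bases of the steps.\<close>

lemma ex_dense_index_above:
  assumes full: "full_c_skeleton X \<Gamma> r F \<B>" and s: "s \<in> \<Gamma>"
  shows "\<exists>t\<in>\<Gamma>. dense_index F \<B> t \<and> (s, t) \<in> r"
proof -
  have skel: "c_skeleton X \<Gamma> r F \<B>" and cover: "topspace X = (\<Union>s\<in>\<Gamma>. F s)"
    using full by (simp_all only: full_c_skeleton_def)
  note sk = c_skeletonD[OF skel]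
  have dsc: "directed_sigma_complete \<Gamma> r" using skel by (simp only: c_skeleton_def)
  have "\<Gamma> \<noteq> {}" using s by blast
  have "\<exists>s\<in>\<Gamma>. x \<in> topspace X \<longrightarrow> x \<in> F s" for x
    using cover s by blast
  then obtain i where i: "\<And>x. i x \<in> \<Gamma>" "\<And>x. x \<in> topspace X \<Longrightarrow> x \<in> F (i x)"
    by metis
  have "\<exists>t. t \<in> \<Gamma> \<and> (s, t) \<in> r \<and> (\<forall>U\<in>\<B> s. U \<noteq> {} \<longrightarrow> U \<inter> F t \<noteq> {})" if s: "s \<in> \<Gamma>" for s
  proof -
    define p where "p U = (SOME x. x \<in> U)" for U :: "'a set"
    have p: "p U \<in> U" if "U \<noteq> {}" for U using that by (simp add: p_def some_in_eq)
    obtain t where t: "t \<in> \<Gamma>" "\<And>c. c \<in> insert s ((\<lambda>U. i (p U)) ` \<B> s) \<Longrightarrow> (c, t) \<in> r"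
    proof (rule countable_upper_bound[OF dsc \<open>\<Gamma> \<noteq> {}\<close>, of "insert s ((\<lambda>U. i (p U)) ` \<B> s)"])
      show "countable (insert s ((\<lambda>U. i (p U)) ` \<B> s))" using sk(5)[OF s] by auto
      show "insert s ((\<lambda>U. i (p U)) ` \<B> s) \<subseteq> \<Gamma>" using s i(1) by auto
    qed blast
    have "U \<inter> F t \<noteq> {}" if U: "U \<in> \<B> s" "U \<noteq> {}" for U
    proof -
      have "p U \<in> topspace X" using p[OF U(2)] sk(5)[OF s] U(1) openin_subset by blast
      then have "p U \<in> F (i (p U))" by (rule i(2))
      moreover have "F (i (p U)) \<subseteq> F t" using sk(7)[OF i(1) t(1)] t(2) U(1) by blast
      ultimately show ?thesis using p[OF U(2)] by blast
    qed
    then show ?thesis using t by blast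
  qed
  then have "\<exists>\<sigma>. \<forall>n. (\<sigma> n \<in> \<Gamma> \<and> (n = 0 \<longrightarrow> \<sigma> n = s)) \<and>
      ((\<sigma> n, \<sigma> (Suc n)) \<in> r \<and> (\<forall>U\<in>\<B> (\<sigma> n). U \<noteq> {} \<longrightarrow> U \<inter> F (\<sigma> (Suc n)) \<noteq> {}))"
    using s by (intro dependent_nat_choice) auto
  then obtain \<sigma> where \<sigma>: "\<And>n. \<sigma> n \<in> \<Gamma>" "\<sigma> 0 = s" "\<And>n. (\<sigma> n, \<sigma> (Suc n)) \<in> r"
    "\<And>n U. U \<in> \<B> (\<sigma> n) \<Longrightarrow> U \<noteq> {} \<Longrightarrow> U \<inter> F (\<sigma> (Suc n)) \<noteq> {}"
    by metis
  then have inc: "increasing_sequence \<Gamma> r \<sigma>" by (simp add: increasing_sequence_def)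
  then obtain t where t: "is_supremum \<Gamma> r (range \<sigma>) t" using sk(3) by blast
  have "dense_index F \<B> t"
    by (rule dense_index_supremum[OF skel inc t]) (use \<sigma>(4) in blast)
  moreover have "t \<in> \<Gamma>" "(s, t) \<in> r" using t \<sigma>(2) by (auto simp: is_supremum_def)
  ultimately show ?thesis by blast
qed

text \<open>If \<open>\<Gamma>\<close> is empty, then so is \<open>X\<close>, and empty families do. Otherwise the monotone choice of indices
  is applied to indices \<open>i x\<close> with \<open>x \<in> F (i x)\<close> and to the density of \<open>F s\<close>. Countable sets are
  covered by one index each, and \<open>\<omega>\<close>-monotonicity identifies its base with the union over the
  finite subsets.\<close>

lemma full_c_skeleton_imp_point_skeleton:
  fixes X :: "'a topology" and \<Gamma> :: "'s set"
  assumes full: "full_c_skeleton X \<Gamma> r F \<B>" and "tychonoff_space X" and "compact_space X"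
  shows "\<exists>B K. point_skeleton X B K"
proof (cases "\<Gamma> = {}")
  case True
  then have "topspace X = {}" using full by (simp add: full_c_skeleton_def)
  then have "point_skeleton X (\<lambda>_. {}) (\<lambda>_. {})"
    using assms(2,3) by unfold_locales auto
  then show ?thesis by blast
next
  case False
  have skel: "c_skeleton X \<Gamma> r F \<B>" and cover: "topspace X = (\<Union>s\<in>\<Gamma>. F s)"
    using full by (simp_all only: full_c_skeleton_def)
  note sk = c_skeletonD[OF skel]
  have dsc: "directed_sigma_complete \<Gamma> r" using skel by (simp only: c_skeleton_def)
  have "\<exists>s\<in>\<Gamma>. x \<in> topspace X \<longrightarrow> x \<in> F s" for x
    using cover False by blast
  then obtain i where i: "\<And>x. i x \<in> \<Gamma>" "\<And>x. x \<in> topspace X \<Longrightarrow> x \<in> F (i x)"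
    by metis
  have dense_sup: "\<forall>\<sigma> s. increasing_sequence \<Gamma> r \<sigma> \<longrightarrow> (\<forall>n. dense_index F \<B> (\<sigma> n)) \<longrightarrow>
      is_supremum \<Gamma> r (range \<sigma>) s \<longrightarrow> dense_index F \<B> s"
  proof (intro allI impI)
    fix \<sigma> s
    assume \<sigma>: "increasing_sequence \<Gamma> r \<sigma>" "is_supremum \<Gamma> r (range \<sigma>) s"
      and dense: "\<forall>n. dense_index F \<B> (\<sigma> n)"
    show "dense_index F \<B> s"
    proof (rule dense_index_supremum[OF skel \<sigma>])
      show "\<exists>m. U \<inter> F (\<sigma> m) \<noteq> {}" if "U \<in> \<B> (\<sigma> n)" "U \<noteq> {}" for n U
        using dense that unfolding dense_index_def by (intro exI[of _ n]) simp
    qed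
  qed
  have dense_cofinal: "\<forall>s\<in>\<Gamma>. \<exists>t\<in>\<Gamma>. dense_index F \<B> t \<and> (s, t) \<in> r"
    using ex_dense_index_above[OF full] by (rule ballI)
  have i\<Gamma>: "\<forall>x. i x \<in> \<Gamma>" using i(1) ..
  obtain u where u0: "\<forall>A. countable A \<longrightarrow> u A \<in> \<Gamma> \<and> dense_index F \<B> (u A) \<and>
      (\<forall>x\<in>A. (i x, u A) \<in> r) \<and> (\<forall>A'\<subseteq>A. (u A', u A) \<in> r) \<and>
      (\<exists>\<alpha>. (\<forall>n. finite (\<alpha> n) \<and> \<alpha> n \<subseteq> A) \<and>
        increasing_sequence \<Gamma> r (u \<circ> \<alpha>) \<and> is_supremum \<Gamma> r (range (u \<circ> \<alpha>)) (u A))"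
    using monotone_choice_countable_sets[OF dsc i\<Gamma> dense_cofinal dense_sup] by (rule exE)
  have u: "u A \<in> \<Gamma>" "dense_index F \<B> (u A)" "\<And>x. x \<in> A \<Longrightarrow> (i x, u A) \<in> r"
      "\<And>A'. A' \<subseteq> A \<Longrightarrow> (u A', u A) \<in> r"
      "\<exists>\<alpha>. (\<forall>n. finite (\<alpha> n) \<and> \<alpha> n \<subseteq> A) \<and>
        increasing_sequence \<Gamma> r (u \<circ> \<alpha>) \<and> is_supremum \<Gamma> r (range (u \<circ> \<alpha>)) (u A)"
    if "countable A" for A
    using u0[rule_format, OF that] by simp_all
  define B where "B S = (\<Union>A\<in>{A. finite A \<and> A \<subseteq> S}. \<B> (u A))" for S
  define K where "K S = (\<Union>A\<in>{A. countable A \<and> A \<subseteq> S}. F (u A))" for S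
  have u_sub: "u A' \<in> \<Gamma>" "(u A', u A) \<in> r" if "countable A" "A' \<subseteq> A" for A A'
    using u(1)[of A'] u(4)[OF that] countable_subset[OF that(2,1)] by auto
  have B_eq: "B A = \<B> (u A)" if A: "countable A" for A
  proof
    show "B A \<subseteq> \<B> (u A)"
      using sk(8)[OF u_sub(1)[OF A] u(1)[OF A] u_sub(2)[OF A]] by (auto simp: B_def)
    obtain \<alpha> where \<alpha>: "\<forall>n. finite (\<alpha> n) \<and> \<alpha> n \<subseteq> A" "increasing_sequence \<Gamma> r (u \<circ> \<alpha>)"
      "is_supremum \<Gamma> r (range (u \<circ> \<alpha>)) (u A)"
      using u(5)[OF A] by (elim exE conjE)
    show "\<B> (u A) \<subseteq> B A" using sk(9)[OF \<alpha>(2,3)] \<alpha>(1) by (auto simp: B_def)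
  qed
  have K_eq: "K A = F (u A)" if A: "countable A" for A
  proof
    show "K A \<subseteq> F (u A)"
      using sk(7)[OF u_sub(1)[OF A] u(1)[OF A] u_sub(2)[OF A]] by (auto simp: K_def)
    show "F (u A) \<subseteq> K A" using A by (auto simp: K_def)
  qed
  have B_mono: "B S \<subseteq> B S'" if "S \<subseteq> S'" for S S'
    using that by (auto simp: B_def)
  have base: "\<exists>\<tau>. topspace \<tau> = topspace X \<and> tychonoff_separated \<tau> (K A) \<and>
      (\<forall>V\<in>B A. openin \<tau> V) \<and> (\<forall>W x. openin \<tau> W \<and> x \<in> W \<longrightarrow> (\<exists>V\<in>B A. x \<in> V \<and> V \<subseteq> W))"
    if A: "countable A" for A
  proof -
    obtain \<tau> where \<tau>: "topspace \<tau> = topspace X" "openin \<tau> = arbitrary union_of (\<lambda>U. U \<in> \<B> (u A))"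
      "tychonoff_separated \<tau> (F (u A))"
      using sk(6)[OF u(1)[OF A]] by (elim exE conjE)
    show ?thesis
      using \<tau>(1,3) \<tau>(2)[unfolded openin_topology_base_unique]
      by (intro exI[of _ \<tau>]) (simp add: B_eq[OF A] K_eq[OF A] Bex_def)
  qed
  have "point_skeleton X B K"
  proof
    show "\<exists>A. finite A \<and> A \<subseteq> S \<and> U \<in> B A" if "U \<in> B S" for U S
      using that by (auto simp: B_def)
    show "openin X U" if "U \<in> B S" for U S
      using that sk(5)[OF u(1)[OF countable_finite]] unfolding B_def by blast
    show "countable (B A)" if "countable A" for A
      using sk(5)[OF u(1)[OF that]] B_eq[OF that] by simp
    show "\<exists>U\<in>B S. x \<in> U" if "x \<in> topspace X" for x S
    proof -
      obtain \<tau> where "topspace \<tau> = topspace X"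
        "\<forall>W x. openin \<tau> W \<and> x \<in> W \<longrightarrow> (\<exists>V\<in>B {}. x \<in> V \<and> V \<subseteq> W)"
        using base[of "{}"] by auto
      then have "\<exists>U\<in>B {}. x \<in> U" using that by (metis openin_topspace)
      then show ?thesis using B_mono[of "{}" S] by blast
    qed
    show "\<exists>W\<in>B S. x \<in> W \<and> W \<subseteq> U \<inter> V" if UV: "U \<in> B S" "V \<in> B S" "x \<in> U \<inter> V" for U V S x
    proof -
      obtain A A' where A: "finite A" "A \<subseteq> S" "U \<in> B A" "finite A'" "A' \<subseteq> S" "V \<in> B A'"
        using UV by (auto simp: B_def)
      let ?C = "A \<union> A'"
      have C: "countable ?C" "U \<in> B ?C" "V \<in> B ?C" "?C \<subseteq> S"
        using A B_mono[of A ?C] B_mono[of A' ?C] by (auto intro: countable_finite)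
      obtain \<tau> where \<tau>: "\<forall>V\<in>B ?C. openin \<tau> V"
        "\<And>W x. openin \<tau> W \<and> x \<in> W \<Longrightarrow> \<exists>V\<in>B ?C. x \<in> V \<and> V \<subseteq> W"
        using base[OF C(1)] by blast
      have "openin \<tau> (U \<inter> V)" using \<tau>(1) C(2,3) by (intro openin_Int) auto
      then have "\<exists>W\<in>B ?C. x \<in> W \<and> W \<subseteq> U \<inter> V" using UV(3) by (intro \<tau>(2)) simp
      then show ?thesis using B_mono[OF C(4)] by blast
    qed
    show "closedin X (K A)" if "countable A" for A
      using sk(4)[OF u(1)[OF that]] K_eq[OF that] by simp
    show "K S = (\<Union>A\<in>{A. countable A \<and> A \<subseteq> S}. K A)" for S
    proof -
      have "(\<Union>A\<in>{A. countable A \<and> A \<subseteq> S}. K A) = (\<Union>A\<in>{A. countable A \<and> A \<subseteq> S}. F (u A))"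
        using K_eq by (intro SUP_cong) auto
      then show ?thesis by (simp add: K_def)
    qed
    show "x \<in> K {x}" if "x \<in> topspace X" for x
    proof -
      have "F (i x) \<subseteq> F (u {x})" by (rule sk(7)[OF i(1) u(1) u(3)]) auto
      then show ?thesis using i(2)[OF that] K_eq[of "{x}"] by auto
    qed
    show "U \<inter> K A \<noteq> {}" if "countable A" "U \<in> B A" "U \<noteq> {}" for A U
      using u(2)[OF that(1)] that K_eq[OF that(1)] B_eq[OF that(1)] by (auto simp: dense_index_def)
    show "\<exists>g :: 'a \<Rightarrow> 'a. inj_on g (K A) \<and> (\<forall>(x, y)\<in>unseparated X (B A). g x = g y)"
      if A: "countable A" for A
    proof -
      obtain \<tau> where \<tau>: "topspace \<tau> = topspace X" "tychonoff_separated \<tau> (K A)"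
        "\<forall>V\<in>B A. openin \<tau> V" "\<forall>W x. openin \<tau> W \<and> x \<in> W \<longrightarrow> (\<exists>V\<in>B A. x \<in> V \<and> V \<subseteq> W)"
        using base[OF A] by (elim exE conjE)
      have nbhd: "\<exists>V\<in>B A. x \<in> V \<and> V \<subseteq> W" if "openin \<tau> W" "x \<in> W" for W x
        using \<tau>(4) that by simp
      obtain Z :: "'a topology" and g where g: "Hausdorff_space Z" "continuous_map \<tau> Z g" "inj_on g (K A)"
        using \<tau>(2) by (auto simp: tychonoff_separated_def tychonoff_space_def)
      have "g x = g y" if xy: "(x, y) \<in> unseparated X (B A)" for x y
      proof (rule ccontr)
        assume ne: "g x \<noteq> g y"
        have xyX: "x \<in> topspace \<tau>" "y \<in> topspace \<tau>" using xy \<tau>(1) by (auto simp: unseparated_def)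
        then have "g x \<in> topspace Z" "g y \<in> topspace Z"
          using continuous_map_image_subset_topspace[OF g(2)] by auto
        then obtain P Q where PQ: "openin Z P" "openin Z Q" "g x \<in> P" "g y \<in> Q" "disjnt P Q"
          using g(1) ne unfolding Hausdorff_space_def by blast
        obtain U where U: "U \<in> B A" "x \<in> U" "U \<subseteq> {z \<in> topspace \<tau>. g z \<in> P}"
          using nbhd[OF openin_continuous_map_preimage[OF g(2) PQ(1)], of x] xyX PQ by blast
        obtain V where V: "V \<in> B A" "y \<in> V" "V \<subseteq> {z \<in> topspace \<tau>. g z \<in> Q}"
          using nbhd[OF openin_continuous_map_preimage[OF g(2) PQ(2)], of y] xyX PQ by blast
        have "U \<inter> V = {}" using U V PQ(5) by (auto simp: disjnt_def)
        then show False using xy U V by (auto simp: unseparated_def)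
      qed
      then show ?thesis using g(3) by blast
    qed
  qed (use assms B_mono in auto)
  then show ?thesis by blast
qed


section \<open>The \<open>c\<close>-skeleton of a subspace of a \<open>\<Sigma>\<close>-product\<close>

lemma continuous_map_into_real_rationalI:
  assumes "\<And>p q. p \<in> \<rat> \<Longrightarrow> q \<in> \<rat> \<Longrightarrow> openin X {x \<in> topspace X. p < f x \<and> f x < q}"
  shows "continuous_map X euclideanreal f"
  unfolding continuous_map_def
proof (intro conjI allI impI)
  fix W :: "real set" assume "openin euclideanreal W"
  then have W: "open W" by simp
  show "openin X {x \<in> topspace X. f x \<in> W}"
  proof (subst openin_subopen, intro ballI)
    fix x assume x: "x \<in> {x \<in> topspace X. f x \<in> W}"
    then obtain e where e: "e > 0" "ball (f x) e \<subseteq> W"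
      using x by (auto intro: openE[OF W, of "f x"])
    obtain p where p: "p \<in> \<rat>" "f x - e < p" "p < f x"
      using Rats_dense_in_real[of "f x - e" "f x"] e(1) by auto
    obtain q where q: "q \<in> \<rat>" "f x < q" "q < f x + e"
      using Rats_dense_in_real[of "f x" "f x + e"] e(1) by auto
    have "z \<in> W" if "p < z" "z < q" for z
    proof -
      have "z \<in> ball (f x) e" using that p q by (auto simp: dist_real_def)
      then show ?thesis using e by blast
    qed
    then show "\<exists>N. openin X N \<and> x \<in> N \<and> N \<subseteq> {x \<in> topspace X. f x \<in> W}"
      using assms[OF p(1) q(1)] x p q by (intro exI[of _ "{x \<in> topspace X. p < f x \<and> f x < q}"]) auto
  qed
qed simp

lemma openin_topology_union_of:
  assumes "\<And>U V. U \<in> \<U> \<Longrightarrow> V \<in> \<U> \<Longrightarrow> U \<inter> V \<in> \<U>"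
  shows "openin (topology (arbitrary union_of (\<lambda>U. U \<in> \<U>))) = arbitrary union_of (\<lambda>U. U \<in> \<U>)"
  using assms by (intro topology_inverse' istopology_base)

text \<open>The index set consists of the countable sets of coordinates, ordered by inclusion, so suprema are
  unions. A box constrains only finitely many coordinates. It therefore appears in the base of a union
  of an increasing sequence only if it appears already at some term. Every point has countable support,
  which makes the skeleton full.\<close>

lemma corson_embedding_imp_full_c_skeleton:
  fixes X :: "'a topology" and T :: "'t set"
  assumes emb: "corson_embedding X T \<phi>"
  shows "\<exists>(\<Gamma> :: 't set set) r F \<B>. full_c_skeleton X \<Gamma> r F \<B>"
proof -
  have em: "embedding_map X (powertop_real T) \<phi>"
    and sp: "\<phi> ` topspace X \<subseteq> sigma_product T"
    using emb by (auto simp: corson_embedding_def)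
  have hom: "homeomorphic_map X (subtopology (powertop_real T) (\<phi> ` topspace X)) \<phi>"
    using em by (simp only: embedding_map_def)
  have cont: "continuous_map X (powertop_real T) \<phi>"
    using homeomorphic_imp_continuous_map[OF hom] by (simp add: continuous_map_in_subtopology)
  have inj: "inj_on \<phi> (topspace X)" using homeomorphic_imp_injective_map[OF hom] .
  have coord: "continuous_map X euclideanreal (\<lambda>x. \<phi> x t)" if "t \<in> T" for t
    using cont that by (simp add: continuous_map_componentwise)
  have ext: "\<phi> x \<in> extensional T" if "x \<in> topspace X" for x
    using sp that by (auto simp: sigma_product_def PiE_def)
  define box where "box G = {x \<in> topspace X. \<forall>t p q. (t, p, q) \<in> G \<longrightarrow> p < \<phi> x t \<and> \<phi> x t < q}"
    for G :: "('t \<times> real \<times> real) set"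
  define F where "F A = {x \<in> topspace X. \<forall>t\<in>T - A. \<phi> x t = 0}" for A
  define \<B> where "\<B> A = box ` {G. finite G \<and> G \<subseteq> A \<times> \<rat> \<times> \<rat>}" for A
  define \<Gamma> where "\<Gamma> = {A. countable A \<and> A \<subseteq> T}"
  define r where "r = {(A, A'). A \<in> \<Gamma> \<and> A' \<in> \<Gamma> \<and> A \<subseteq> A'}"
  have box_Int: "box (G \<union> H) = box G \<inter> box H" for G H
    by (auto simp: box_def)
  have \<B>_Int: "U \<inter> V \<in> \<B> A" if UV: "U \<in> \<B> A" "V \<in> \<B> A" for U V A
  proof -
    obtain G H where "finite G" "G \<subseteq> A \<times> \<rat> \<times> \<rat>" "U = box G" "finite H" "H \<subseteq> A \<times> \<rat> \<times> \<rat>" "V = box H"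
      using UV unfolding \<B>_def by (elim imageE CollectE conjE)
    then show ?thesis unfolding \<B>_def by (intro image_eqI[of _ _ "G \<union> H"]) (auto simp: box_Int)
  qed
  have open_coord: "openin X {x \<in> topspace X. p < \<phi> x t \<and> \<phi> x t < q}" if "t \<in> T" for t p q
    using openin_continuous_map_preimage[OF coord[OF that], of "{p<..<q}"] by simp
  have open_box: "openin X (box G)" if "finite G" "G \<subseteq> T \<times> \<rat> \<times> \<rat>" for G
    using that
  proof (induction G)
    case empty
    then show ?case by (simp add: box_def)
  next
    case (insert g G)
    obtain t p q where g: "g = (t, p, q)" by (cases g)
    have "box (insert g G) = {x \<in> topspace X. p < \<phi> x t \<and> \<phi> x t < q} \<inter> box G"
      by (auto simp: box_def g)
    then show ?case using insert open_coord[of t p q] g by auto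
  qed
  have \<B>_open: "openin X U" if "A \<in> \<Gamma>" "U \<in> \<B> A" for A U
  proof -
    obtain G where "finite G" "G \<subseteq> A \<times> \<rat> \<times> \<rat>" "U = box G"
      using \<open>U \<in> \<B> A\<close> unfolding \<B>_def by (elim imageE CollectE conjE)
    moreover from this have "G \<subseteq> T \<times> \<rat> \<times> \<rat>" using \<open>A \<in> \<Gamma>\<close> by (auto simp: \<Gamma>_def)
    ultimately show ?thesis using open_box by simp
  qed
  have \<B>_countable: "countable (\<B> A)" if "A \<in> \<Gamma>" for A
  proof -
    have "countable (A \<times> \<rat> \<times> (\<rat> :: real set))"
      using that by (intro countable_SIGMA countable_rat) (simp add: \<Gamma>_def)
    then show ?thesis unfolding \<B>_def by (intro countable_image countable_Collect_finite_subset)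
  qed
  have \<B>_mono: "\<B> A \<subseteq> \<B> A'" if "A \<subseteq> A'" for A A'
    using that unfolding \<B>_def by (intro image_mono) auto
  have sup_UN: "(\<Union>n. \<sigma> n) \<in> \<Gamma>" "is_supremum \<Gamma> r (range \<sigma>) (\<Union>n. \<sigma> n)"
    if "increasing_sequence \<Gamma> r \<sigma>" for \<sigma>
  proof -
    show U: "(\<Union>n. \<sigma> n) \<in> \<Gamma>" using that by (auto simp: increasing_sequence_def \<Gamma>_def)
    have "\<sigma> n \<in> \<Gamma>" for n using that by (simp add: increasing_sequence_def)
    then show "is_supremum \<Gamma> r (range \<sigma>) (\<Union>n. \<sigma> n)"
      using U by (auto simp: is_supremum_def r_def)
  qed
  have sup_eq: "u = (\<Union>n. \<sigma> n)" if "increasing_sequence \<Gamma> r \<sigma>" "is_supremum \<Gamma> r (range \<sigma>) u" for \<sigma> u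
  proof
    have "(u, \<Union>n. \<sigma> n) \<in> r"
      using that(2) sup_UN[OF that(1)] by (simp add: is_supremum_def)
    then show "u \<subseteq> (\<Union>n. \<sigma> n)" by (simp add: r_def)
    show "(\<Union>n. \<sigma> n) \<subseteq> u" using that(2) by (auto simp: is_supremum_def r_def)
  qed
  have dsc: "directed_sigma_complete \<Gamma> r"
    unfolding directed_sigma_complete_def
  proof (intro conjI ballI allI impI)
    show "partial_order_on \<Gamma> r"
      by (auto simp: partial_order_on_def preorder_on_def refl_on_def trans_def antisym_def r_def)
    show "\<exists>u\<in>\<Gamma>. (s, u) \<in> r \<and> (t, u) \<in> r" if "s \<in> \<Gamma>" "t \<in> \<Gamma>" for s t
      using that by (intro bexI[of _ "s \<union> t"]) (auto simp: r_def \<Gamma>_def)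
    show "\<exists>u. is_supremum \<Gamma> r (range \<sigma>) u" if "increasing_sequence \<Gamma> r \<sigma>" for \<sigma>
      using sup_UN(2)[OF that] by (rule exI)
  qed
  have om: "omega_monotone \<Gamma> r {U. openin X U} \<B>"
    unfolding omega_monotone_def
  proof (intro conjI ballI allI impI)
    show "\<B> \<in> \<Gamma> \<rightarrow> {A. A \<subseteq> {U. openin X U} \<and> countable A}"
      using \<B>_open \<B>_countable by auto
    show "\<B> s \<subseteq> \<B> t" if "(s, t) \<in> r" for s t
      using that by (intro \<B>_mono) (auto simp: r_def)
    fix \<sigma> u assume \<sigma>: "increasing_sequence \<Gamma> r \<sigma> \<and> is_supremum \<Gamma> r (range \<sigma>) u"
    then have u: "u = (\<Union>n. \<sigma> n)" using sup_eq by blast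
    have "\<sigma> n \<subseteq> \<sigma> (Suc n)" for n
      using \<sigma> by (simp add: increasing_sequence_def r_def)
    then have inc: "\<sigma> m \<subseteq> \<sigma> n" if "m \<le> n" for m n
      using that by (rule lift_Suc_mono_le)
    show "\<B> u = (\<Union>n. \<B> (\<sigma> n))"
    proof
      show "(\<Union>n. \<B> (\<sigma> n)) \<subseteq> \<B> u" unfolding u by (intro UN_least \<B>_mono) auto
      show "\<B> u \<subseteq> (\<Union>n. \<B> (\<sigma> n))"
      proof
        fix U assume "U \<in> \<B> u"
        then obtain G where G: "finite G" "G \<subseteq> u \<times> \<rat> \<times> \<rat>" "U = box G"
          unfolding \<B>_def by (elim imageE CollectE conjE)
        obtain n where n: "G \<subseteq> \<sigma> n \<times> \<rat> \<times> \<rat>"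
        proof (rule finite_subset_chain_UN[where A = G and I = UNIV and D = "\<lambda>n. \<sigma> n \<times> \<rat> \<times> \<rat>"])
          show "finite G" by (rule G(1))
          show "G \<subseteq> (\<Union>n. \<sigma> n \<times> \<rat> \<times> \<rat>)" using G(2) u by blast
          show "\<sigma> i \<times> \<rat> \<times> \<rat> \<subseteq> \<sigma> j \<times> \<rat> \<times> \<rat> \<or> \<sigma> j \<times> \<rat> \<times> \<rat> \<subseteq> (\<sigma> i \<times> \<rat> \<times> \<rat> :: ('t \<times> real \<times> real) set)" for i j
            using inc[of i j] inc[of j i] by (cases "i \<le> j") auto
        qed auto
        then show "U \<in> (\<Union>n. \<B> (\<sigma> n))" using G by (auto simp: \<B>_def)
      qed
    qed
  qed
  have closed: "closedin X (F A)" for A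
  proof -
    have "F A = topspace X - (\<Union>t\<in>T - A. {x \<in> topspace X. \<phi> x t \<in> - {0}})"
      by (auto simp: F_def)
    moreover have "openin X {x \<in> topspace X. \<phi> x t \<in> - {0}}" if "t \<in> T - A" for t
      using openin_continuous_map_preimage[OF coord, of t "- {0}"] that by auto
    then have "openin X (\<Union>t\<in>T - A. {x \<in> topspace X. \<phi> x t \<in> - {0}})"
      by (intro openin_Union) blast
    ultimately show ?thesis by (simp only: closedin_diff[OF closedin_topspace])
  qed
  have sep: "\<exists>\<tau>. topspace \<tau> = topspace X \<and> openin \<tau> = arbitrary union_of (\<lambda>U. U \<in> \<B> A) \<and>
      tychonoff_separated \<tau> (F A)" if A: "A \<in> \<Gamma>" for A
  proof -
    define \<tau> where "\<tau> = topology (arbitrary union_of (\<lambda>U. U \<in> \<B> A))"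
    have op: "openin \<tau> = arbitrary union_of (\<lambda>U. U \<in> \<B> A)"
      unfolding \<tau>_def by (rule openin_topology_union_of) (rule \<B>_Int)
    then have op_base: "openin \<tau> U" if "U \<in> \<B> A" for U
      using op[unfolded openin_topology_base_unique] that by simp
    have "topspace X = box {}" by (simp add: box_def)
    then have "topspace X \<in> \<B> A" by (auto simp: \<B>_def)
    moreover have "U \<subseteq> topspace X" if "openin \<tau> U" for U
    proof
      fix x assume "x \<in> U"
      then have "openin \<tau> U \<and> x \<in> U" using that by simp
      then obtain V where "V \<in> \<B> A" "x \<in> V"
        using op[unfolded openin_topology_base_unique, THEN conjunct2, rule_format, of U x] by blast
      then show "x \<in> topspace X" using openin_subset[OF \<B>_open[OF A]] by blast
    qed
    ultimately have top: "topspace \<tau> = topspace X"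
      using op_base openin_subset[of \<tau> "topspace X"] openin_topspace[of \<tau>] by blast
    define g where "g x = (\<lambda>t\<in>A. \<phi> x t)" for x
    have "continuous_map \<tau> (powertop_real A) g"
      unfolding continuous_map_componentwise
    proof (intro conjI ballI)
      show "g ` topspace \<tau> \<subseteq> extensional A" by (auto simp: g_def)
      fix t assume t: "t \<in> A"
      have "continuous_map \<tau> euclideanreal (\<lambda>x. \<phi> x t)"
      proof (rule continuous_map_into_real_rationalI)
        fix p q :: real assume pq: "p \<in> \<rat>" "q \<in> \<rat>"
        have "box {(t, p, q)} \<in> \<B> A" using pq t by (auto simp: \<B>_def)
        moreover have "box {(t, p, q)} = {x \<in> topspace \<tau>. p < \<phi> x t \<and> \<phi> x t < q}"
          by (simp add: box_def top)
        ultimately show "openin \<tau> {x \<in> topspace \<tau>. p < \<phi> x t \<and> \<phi> x t < q}"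
          by (metis op_base)
      qed
      then show "continuous_map \<tau> euclideanreal (\<lambda>x. g x t)" using t by (simp add: g_def)
    qed
    moreover have "inj_on g (F A)"
    proof (rule inj_onI)
      fix x y assume xy: "x \<in> F A" "y \<in> F A" "g x = g y"
      then have X: "x \<in> topspace X" "y \<in> topspace X" by (auto simp: F_def)
      have "\<phi> x t = \<phi> y t" if "t \<in> T" for t
        using fun_cong[OF xy(3), of t] xy(1,2) that by (cases "t \<in> A") (auto simp: g_def F_def)
      then have "\<phi> x = \<phi> y" using ext[OF X(1)] ext[OF X(2)] by (intro extensionalityI)
      then show "x = y" using inj X by (auto dest: inj_onD)
    qed
    moreover have "tychonoff_space (powertop_real A)"
      by (simp add: tychonoff_space_def completely_regular_space_product_topology
          Hausdorff_space_product_topology metrizable_imp_completely_regular_space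
          metrizable_space_euclidean)
    moreover have "F A \<subseteq> topspace \<tau>" by (auto simp: F_def top)
    ultimately have "tychonoff_separated \<tau> (F A)"
      using tychonoff_separatedI[of "powertop_real A" \<tau> g "F A"] by simp
    then show ?thesis using top op by (intro exI[of _ \<tau>] conjI)
  qed
  have "x \<in> F {t \<in> T. \<phi> x t \<noteq> 0}" "{t \<in> T. \<phi> x t \<noteq> 0} \<in> \<Gamma>" if "x \<in> topspace X" for x
    using that sp by (auto simp: F_def \<Gamma>_def sigma_product_def)
  then have "topspace X \<subseteq> (\<Union>s\<in>\<Gamma>. F s)" by blast
  moreover have "F A \<subseteq> topspace X" for A by (auto simp: F_def)
  ultimately have cover: "topspace X = (\<Union>s\<in>\<Gamma>. F s)" by blast
  have "full_c_skeleton X \<Gamma> r F \<B>"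
    unfolding full_c_skeleton_def c_skeleton_def
  proof (intro conjI ballI impI)
    show "F s \<subseteq> F t" if "(s, t) \<in> r" for s t using that by (auto simp: F_def r_def)
  qed (simp_all add: dsc closed \<B>_countable \<B>_open sep om cover[symmetric])
  then show ?thesis by blast
qed

section \<open>Corson compact spaces and full \<open>c\<close>-skeletons\<close>

theorem corollary5p6:
  fixes X :: "'a topology"
  assumes "tychonoff_space X" and "compact_space X"
  shows "corson_space X \<longleftrightarrow> has_full_c_skeleton X"
proof
  assume "corson_space X"
  then obtain T :: "('a \<Rightarrow> real) set" and \<phi> where "corson_embedding X T \<phi>"
    unfolding corson_space_def by blast
  then obtain \<Gamma> :: "('a \<Rightarrow> real) set set" and r F \<B> where "full_c_skeleton X \<Gamma> r F \<B>"
    using corson_embedding_imp_full_c_skeleton by blast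
  then show "has_full_c_skeleton X" by (rule has_full_c_skeletonI)
next
  assume "has_full_c_skeleton X"
  then obtain \<Gamma> :: "('a \<Rightarrow> real) set" and r F \<B> where "full_c_skeleton X \<Gamma> r F \<B>"
    unfolding has_full_c_skeleton_def by blast
  then obtain B K where "point_skeleton X B K"
    using full_c_skeleton_imp_point_skeleton assms by blast
  then show "corson_space X" by (rule point_skeleton.corson_space_of_skeleton)
qed

end
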